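(* Let $X$ be a CAT(0) space. If $G\le\operatorname{Isom}X$ acts properly on $X$, then every rank-one (that is, contracting) element of $G$ is a WPD loxodromic of the curtain model $X_D$ with respect to $G$.
   Context: **Curtains.** Let $(X,d)$ be a CAT(0) space. A geodesic is an isometric embedding $\alpha:I\to X$ of an interval $I\subset\mathbb R$, and $\pi_\alpha:X\to\alpha$ is closest-point projection. For $r$ with $[r-\frac12,r+\frac12]$ in the interior of $I$, the curtain dual to $\alpha$ at $r$ is $h=h_{\alpha,r}=\pi_\alpha^{-1}(\alpha[r-\frac12,r+\frac12])$. Its halfspaces are $h^-=\pi_\alpha^{-1}\alpha(I\cap(-\infty,r-\frac12))$ and $h^+=\pi_\alpha^{-1}\alpha(I\cap(r+\frac12,\infty))$. The curtain $h$ separates $A,B\subset X$ if one of them is contained in $h^-$ and the other in $h^+$. A chain is a set of pairwise disjoint curtains $\{h_i\}$, indexed by consecutive integers, such that $h_i$ separates $h_{i-1}$ from $h_{i+1}$ for all $i$; it separates $A$ from $B$ if every $h_i$ does. **$L$-separation and $d_L$.** For $L\in\mathbb N=\{0,1,2,\dots\}$, disjoint curtains $h,h'$ are $L$-separated if every chain all of whose elements meet both $h$ and $h'$ has cardinality at most $L$. An $L$-chain is a chain whose elements are pairwise $L$-separated. Set $d_L(x,x)=0$ and, for $x\neq y$, $d_L(x,y)=1+\max\{|c| : c \text{ is an } L\text{-chain separating } x \text{ from } y\}$. **Curtain model.** Fix numbers $\lambda_L\in(0,1)$, $L\ge1$, with $\sum\lambda_L<\sum L\lambda_L<\sum L^2\lambda_L=\Lambda<\infty$.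 Put $D(x,y)=\sum_{L=1}^\infty\lambda_L d_L(x,y)$. The curtain model is $X_D=(X,D)$, on which $\operatorname{Isom}X$ acts by isometries. **Contracting isometries.** A geodesic $\gamma$ is contracting if there is $R$ such that $\operatorname{diam}\pi_\gamma(B)\le R$ for every ball $B$ disjoint from $\gamma$. A hyperbolic isometry (one having an axis on which it translates nontrivially) is contracting if one (hence all) of its axes is contracting. In proper CAT(0) spaces this is equivalent to being rank-one. **WPD.** Let $G$ act by isometries on a metric space $(Y,\rho)$. An infinite-order element $g\in G$ is a WPD loxodromic if it has a quasiisometrically embedded orbit ($n\mapsto g^ny$ is a quasiisometric embedding of $\mathbb Z$) and for each $\varepsilon>0$ and each $x\in Y$ there exists $m>0$ such that $|\{h\in G : \rho(x,hx)<\varepsilon,\ \rho(g^mx,hg^mx)<\varepsilon\}|<\infty$. Proper action means that for every ball $B\subset X$ the set $\{g\in G : gB\cap B\ne\varnothing\}$ is finite. *)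

theory Defs
  imports "HOL-Analysis.Analysis" "HOL-Algebra.Group"
begin

section \<open>CAT(0) spaces\<close>

definition geodesic :: "real set \<Rightarrow> (real \<Rightarrow> 'a::metric_space) \<Rightarrow> bool" where
  "geodesic I \<alpha> \<longleftrightarrow> is_interval I \<and> (\<forall>s\<in>I. \<forall>t\<in>I. dist (\<alpha> s) (\<alpha> t) = \<bar>s - t\<bar>)"

definition geodesic_between :: "'a::metric_space \<Rightarrow> 'a \<Rightarrow> (real \<Rightarrow> 'a) \<Rightarrow> bool" where
  "geodesic_between x y \<alpha> \<longleftrightarrow>
     geodesic {0..dist x y} \<alpha> \<and> \<alpha> 0 = x \<and> \<alpha> (dist x y) = y"

text \<open>\<open>p'\<close> is the comparison point, on the Euclidean side from \<open>x'\<close> to \<open>y'\<close>,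
  of the point \<open>p\<close> on the side \<open>\<alpha>\<close> from \<open>x\<close> to \<open>y\<close>.\<close>

definition comparison_point ::
  "'a::metric_space \<Rightarrow> 'a \<Rightarrow> (real \<Rightarrow> 'a) \<Rightarrow> real^2 \<Rightarrow> real^2 \<Rightarrow> 'a \<Rightarrow> real^2 \<Rightarrow> bool" where
  "comparison_point x y \<alpha> x' y' p p' \<longleftrightarrow>
     p \<in> \<alpha> ` {0..dist x y} \<and> p' \<in> closed_segment x' y' \<and> dist x' p' = dist x p"

class cat0_space = metric_space +
  assumes geodesic_between_exists: "\<exists>\<alpha>. geodesic_between x y \<alpha>"
  and cat0_comparison:
    "\<lbrakk>geodesic_between x y \<alpha>; geodesic_between y z \<beta>; geodesic_between z x \<gamma>;
      dist x' y' = dist x y; dist y' z' = dist y z; dist z' x' = dist z x;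
      comparison_point x y \<alpha> x' y' p p' \<or> comparison_point y z \<beta> y' z' p p' \<or>
        comparison_point z x \<gamma> z' x' p p';
      comparison_point x y \<alpha> x' y' q q' \<or> comparison_point y z \<beta> y' z' q q' \<or>
        comparison_point z x \<gamma> z' x' q q'\<rbrakk>
     \<Longrightarrow> dist p q \<le> dist p' q'"

section \<open>Curtains and chains\<close>

definition is_closest :: "'a::metric_space set \<Rightarrow> 'a \<Rightarrow> 'a \<Rightarrow> bool" where
  "is_closest S x p \<longleftrightarrow> p \<in> S \<and> (\<forall>q\<in>S. dist x p \<le> dist x q)"

definition closest_proj :: "'a::metric_space set \<Rightarrow> 'a \<Rightarrow> 'a" where
  "closest_proj S x = (THE p. is_closest S x p)"

text \<open>The last conjunct says that the projection \<open>\<pi>\<^sub>\<alpha>\<close> is defined on the whole space. In a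
  CAT(0) space it always holds when \<open>I\<close> is closed (\<open>\<alpha> ` I\<close> is then convex and complete), but
  it can fail, for instance, for open bounded \<open>I\<close>.\<close>

definition curtain_data :: "real set \<Rightarrow> (real \<Rightarrow> 'a::metric_space) \<Rightarrow> real \<Rightarrow> bool" where
  "curtain_data I \<alpha> r \<longleftrightarrow>
     geodesic I \<alpha> \<and> {r - 1/2..r + 1/2} \<subseteq> interior I \<and> (\<forall>x. \<exists>!p. is_closest (\<alpha> ` I) x p)"

definition curtain :: "real set \<Rightarrow> (real \<Rightarrow> 'a::metric_space) \<Rightarrow> real \<Rightarrow> 'a set" where
  "curtain I \<alpha> r = closest_proj (\<alpha> ` I) -` (\<alpha> ` {r - 1/2..r + 1/2})"

definition halfspace_minus :: "real set \<Rightarrow> (real \<Rightarrow> 'a::metric_space) \<Rightarrow> real \<Rightarrow> 'a set" where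
  "halfspace_minus I \<alpha> r = closest_proj (\<alpha> ` I) -` (\<alpha> ` (I \<inter> {..<r - 1/2}))"

definition halfspace_plus :: "real set \<Rightarrow> (real \<Rightarrow> 'a::metric_space) \<Rightarrow> real \<Rightarrow> 'a set" where
  "halfspace_plus I \<alpha> r = closest_proj (\<alpha> ` I) -` (\<alpha> ` (I \<inter> {r + 1/2<..}))"

definition is_curtain :: "'a::metric_space set \<Rightarrow> bool" where
  "is_curtain h \<longleftrightarrow> (\<exists>I \<alpha> r. curtain_data I \<alpha> r \<and> h = curtain I \<alpha> r)"

text \<open>Curtains are subsets of the space. The halfspaces of \<open>h\<close> are the connected components of
  its complement, so up to exchanging them they do not depend on the presentation chosen by the
  existential quantifier.\<close>

definition separates :: "'a::metric_space set \<Rightarrow> 'a set \<Rightarrow> 'a set \<Rightarrow> bool" where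
  "separates h A B \<longleftrightarrow>
     (\<exists>I \<alpha> r. curtain_data I \<alpha> r \<and> h = curtain I \<alpha> r \<and>
        (A \<subseteq> halfspace_minus I \<alpha> r \<and> B \<subseteq> halfspace_plus I \<alpha> r \<or>
         B \<subseteq> halfspace_minus I \<alpha> r \<and> A \<subseteq> halfspace_plus I \<alpha> r))"

text \<open>The index set \<open>J\<close> is a set of consecutive integers: empty, finite, or infinite in one or
  both directions.\<close>

definition chain :: "'a::metric_space set set \<Rightarrow> bool" where
  "chain c \<longleftrightarrow>
     (\<exists>(J :: int set) h. c = h ` J \<and>
        (\<forall>i\<in>J. \<forall>k\<in>J. {i..k} \<subseteq> J) \<and>
        (\<forall>i\<in>J. is_curtain (h i)) \<and>
        (\<forall>i\<in>J. \<forall>j\<in>J. i \<noteq> j \<longrightarrow> h i \<inter> h j = {}) \<and>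
        (\<forall>i. {i - 1, i, i + 1} \<subseteq> J \<longrightarrow> separates (h i) (h (i - 1)) (h (i + 1))))"

definition chain_separates :: "'a::metric_space set set \<Rightarrow> 'a set \<Rightarrow> 'a set \<Rightarrow> bool" where
  "chain_separates c A B \<longleftrightarrow> (\<forall>h\<in>c. separates h A B)"

definition L_separated :: "nat \<Rightarrow> 'a::metric_space set \<Rightarrow> 'a set \<Rightarrow> bool" where
  "L_separated L h h' \<longleftrightarrow>
     is_curtain h \<and> is_curtain h' \<and> h \<inter> h' = {} \<and>
     (\<forall>c. chain c \<and> (\<forall>k\<in>c. k \<inter> h \<noteq> {} \<and> k \<inter> h' \<noteq> {}) \<longrightarrow> finite c \<and> card c \<le> L)"

definition L_chain :: "nat \<Rightarrow> 'a::metric_space set set \<Rightarrow> bool" where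
  "L_chain L c \<longleftrightarrow> chain c \<and> (\<forall>h\<in>c. \<forall>h'\<in>c. h \<noteq> h' \<longrightarrow> L_separated L h h')"

section \<open>The curtain model\<close>

text \<open>In a CAT(0) space the maximum exists: disjoint curtains separating \<open>x\<close> from \<open>y\<close> cut
  disjoint subsegments of length at least 1 out of the geodesic from \<open>x\<close> to \<open>y\<close>, so a chain
  separating \<open>x\<close> from \<open>y\<close> is finite, with at most \<open>dist x y\<close> elements.\<close>

definition curtain_dist_L :: "nat \<Rightarrow> 'a::metric_space \<Rightarrow> 'a \<Rightarrow> nat" where
  "curtain_dist_L L x y =
     (if x = y then 0
      else 1 + Max {card c |c. L_chain L c \<and> chain_separates c {x} {y}})"

text \<open>Weights are indexed from 1; the value \<open>w 0\<close> is never used.\<close>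

definition curtain_weights :: "(nat \<Rightarrow> real) \<Rightarrow> bool" where
  "curtain_weights w \<longleftrightarrow>
     (\<forall>L\<ge>1. 0 < w L \<and> w L < 1) \<and>
     summable (\<lambda>L. w (Suc L)) \<and>
     summable (\<lambda>L. real (Suc L) * w (Suc L)) \<and>
     summable (\<lambda>L. (real (Suc L))\<^sup>2 * w (Suc L)) \<and>
     (\<Sum>L. w (Suc L)) < (\<Sum>L. real (Suc L) * w (Suc L)) \<and>
     (\<Sum>L. real (Suc L) * w (Suc L)) < (\<Sum>L. (real (Suc L))\<^sup>2 * w (Suc L))"

definition curtain_dist :: "(nat \<Rightarrow> real) \<Rightarrow> 'a::metric_space \<Rightarrow> 'a \<Rightarrow> real" where
  "curtain_dist w x y = (\<Sum>L. w (Suc L) * real (curtain_dist_L (Suc L) x y))"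

section \<open>Isometries and actions\<close>

definition isom_group :: "('a::metric_space \<Rightarrow> 'a) monoid" where
  "isom_group =
     \<lparr>carrier = {f. bij f \<and> (\<forall>x y. dist (f x) (f y) = dist x y)}, mult = (\<circ>), one = id\<rparr>"

definition acts_properly :: "('a::metric_space \<Rightarrow> 'a) set \<Rightarrow> bool" where
  "acts_properly G \<longleftrightarrow> (\<forall>x r. finite {g \<in> G. g ` ball x r \<inter> ball x r \<noteq> {}})"

definition contracting_geodesic :: "real set \<Rightarrow> (real \<Rightarrow> 'a::metric_space) \<Rightarrow> bool" where
  "contracting_geodesic I \<gamma> \<longleftrightarrow>
     geodesic I \<gamma> \<and>
     (\<exists>R. \<forall>x r. ball x r \<inter> \<gamma> ` I = {} \<longrightarrow>
        bounded (closest_proj (\<gamma> ` I) ` ball x r) \<and>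
        diameter (closest_proj (\<gamma> ` I) ` ball x r) \<le> R)"

definition is_axis :: "('a::metric_space \<Rightarrow> 'a) \<Rightarrow> (real \<Rightarrow> 'a) \<Rightarrow> bool" where
  "is_axis g \<gamma> \<longleftrightarrow> geodesic UNIV \<gamma> \<and> (\<exists>\<tau>. \<tau> \<noteq> 0 \<and> (\<forall>t. g (\<gamma> t) = \<gamma> (t + \<tau>)))"

definition contracting_isometry :: "('a::metric_space \<Rightarrow> 'a) \<Rightarrow> bool" where
  "contracting_isometry g \<longleftrightarrow>
     g \<in> carrier isom_group \<and> (\<exists>\<gamma>. is_axis g \<gamma> \<and> contracting_geodesic UNIV \<gamma>)"

definition qi_embedding_int :: "('y \<Rightarrow> 'y \<Rightarrow> real) \<Rightarrow> (int \<Rightarrow> 'y) \<Rightarrow> bool" where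
  "qi_embedding_int \<rho> f \<longleftrightarrow>
     (\<exists>K\<ge>1. \<exists>C\<ge>0. \<forall>m n.
        \<bar>real_of_int m - real_of_int n\<bar> / K - C \<le> \<rho> (f m) (f n) \<and>
        \<rho> (f m) (f n) \<le> K * \<bar>real_of_int m - real_of_int n\<bar> + C)"

text \<open>For a group \<open>G\<close> acting by isometries on the metric space \<open>(Y, \<rho>)\<close> via \<open>\<phi>\<close>.\<close>

definition WPD_loxodromic ::
  "('g, 'b) monoid_scheme \<Rightarrow> 'y set \<Rightarrow> ('y \<Rightarrow> 'y \<Rightarrow> real) \<Rightarrow> ('g \<Rightarrow> 'y \<Rightarrow> 'y) \<Rightarrow> 'g \<Rightarrow> bool" where
  "WPD_loxodromic G Y \<rho> \<phi> g \<longleftrightarrow>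
     g \<in> carrier G \<and>
     (\<forall>n::nat. n > 0 \<longrightarrow> g [^]\<^bsub>G\<^esub> n \<noteq> \<one>\<^bsub>G\<^esub>) \<and>
     (\<exists>y\<in>Y. qi_embedding_int \<rho> (\<lambda>n. \<phi> (g [^]\<^bsub>G\<^esub> n) y)) \<and>
     (\<forall>\<epsilon>>0. \<forall>x\<in>Y. \<exists>m::nat. m > 0 \<and>
        finite {h \<in> carrier G. \<rho> x (\<phi> h x) < \<epsilon> \<and>
          \<rho> (\<phi> (g [^]\<^bsub>G\<^esub> m) x) (\<phi> h (\<phi> (g [^]\<^bsub>G\<^esub> m) x)) < \<epsilon>})"

end

theory Submission
  imports Defs
begin

text \<open>
  Let \<open>\<gamma>\<close> be a contracting axis of \<open>g\<close>, and call the parameter on \<open>\<gamma>\<close> of the closest point of \<open>x\<close> the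
  foot of \<open>x\<close>. Everything rests on one lower bound, \<open>proj_coord_le_curtain_dist_L\<close>: for a suitable \<open>L\<close>,
  the distance \<open>d\<^sub>L\<close>, and with it the metric \<open>D\<close> of the curtain model, is at least a linear function of
  the distance of the feet.

  The lower bound gives one half of the quasiisometric embedding of the orbit of \<open>\<gamma> 0\<close>; the other
  half is \<open>d\<^sub>L \<le> 1 + d\<close>, which holds because disjoint curtains separating two points cut disjoint unit
  segments out of the geodesic between them (\<open>card_disjoint_separating_le\<close>).

  The finiteness condition follows with little further geometry. Suppose that \<open>h\<close> moves \<open>x\<close> and \<open>y = g\<^sup>m x\<close>
  by less than \<open>\<epsilon>\<close> in \<open>D\<close>. By the lower bound it moves their feet by at most some \<open>B\<close> that does not
  depend on \<open>m\<close>. If \<open>m\<close> is large, the feet of \<open>h x\<close> and \<open>h y\<close> are further apart than the shadow of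
  any ball that misses \<open>\<gamma>\<close>, although \<open>d (h x) (h y) = d x y\<close>. So \<open>h x\<close> is at distance at most
  \<open>d x y\<close> from \<open>\<gamma>\<close> and over a bounded piece of it (\<open>isometry_displacement\<close>). Only
  finitely many \<open>h\<close> do this, since the action is proper. The bound depends on \<open>x\<close> and \<open>m\<close>, which the
  condition permits.

  For the lower bound one has to see that curtains dual to \<open>\<gamma>\<close> at a fixed large spacing are pairwise
  \<open>L\<close>-separated, for one \<open>L\<close>. Let a chain consist of curtains that meet two of them. Each element contains a
  geodesic whose foot crosses a prescribed interval of \<open>\<gamma>\<close>, and contraction forces it to come close to
  \<open>\<gamma>\<close> there (\<open>curtain_crossing_near_line\<close>). So all elements meet one bounded set. The
  sides of the elements of a chain are nested, hence the inner elements separate the first from the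
  last, and their number is bounded by the diameter of that set
  (\<open>chain_meeting_bounded_set\<close>).
\<close>

section \<open>Comparison triangles and the Stewart inequality\<close>

lemma euclidean_comparison_triangle:
  fixes a b c :: real
  assumes "a \<le> b + c" "b \<le> a + c" "c \<le> a + b"
  shows "\<exists>x y z :: real^2. dist x y = a \<and> dist y z = b \<and> dist z x = c"
proof -
  have nn: "a \<ge> 0" "b \<ge> 0" "c \<ge> 0" using assms by auto
  have norm2: "norm (vector [u, v] :: real^2) = sqrt (u\<^sup>2 + v\<^sup>2)" for u v
    by (simp add: norm_vec_def L2_set_def sum_2)
  have diff2: "(vector [u, v] :: real^2) - vector [u', v'] = vector [u - u', v - v']" for u v u' v'
    by (simp add: vec_eq_iff forall_2)
  have dist2: "dist (vector [u, v] :: real^2) (vector [u', v']) = sqrt ((u-u')\<^sup>2 + (v-v')\<^sup>2)" for u v u' v'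
    by (simp add: dist_norm diff2 norm2)
  show ?thesis
  proof (cases "a = 0")
    case True
    then have "b = c" using assms by auto
    then show ?thesis
      using True nn
      by (intro exI[of _ "vector [0,0]"] exI[of _ "vector [0,0]"] exI[of _ "vector [b,0]"])
        (simp add: dist2)
  next
    case False
    then have a: "a > 0" using nn by auto
    define u where "u = (a\<^sup>2 + c\<^sup>2 - b\<^sup>2) / (2*a)"
    have au: "2*a*u = a\<^sup>2 + c\<^sup>2 - b\<^sup>2" using a by (simp add: u_def)
    have "(a - c)\<^sup>2 \<le> b\<^sup>2" using assms nn by (intro power2_le_iff_abs_le[THEN iffD2]) auto
    then have "2*a*u \<le> 2*a*c" using au by (simp add: power2_diff)
    then have u1: "u \<le> c" using a by simp
    have "b\<^sup>2 \<le> (a + c)\<^sup>2" using assms nn by (intro power_mono) auto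
    then have "2*a*(-c) \<le> 2*a*u" using au by (simp add: power2_sum)
    then have u2: "-c \<le> u" using a by (simp only: mult_le_cancel_left_pos[of "2*a"])
    have "u\<^sup>2 \<le> c\<^sup>2" using u1 u2 nn by (intro power2_le_iff_abs_le[THEN iffD2]) auto
    then have v: "(sqrt (c\<^sup>2 - u\<^sup>2))\<^sup>2 = c\<^sup>2 - u\<^sup>2" by simp
    have "dist (vector [a,0] :: real^2) (vector [u, sqrt (c\<^sup>2 - u\<^sup>2)]) = sqrt ((a-u)\<^sup>2 + (c\<^sup>2 - u\<^sup>2))"
      by (simp add: dist2 v)
    also have "(a-u)\<^sup>2 + (c\<^sup>2 - u\<^sup>2) = b\<^sup>2" using au by (simp add: power2_diff)
    finally have "dist (vector [a,0] :: real^2) (vector [u, sqrt (c\<^sup>2 - u\<^sup>2)]) = b" using nn by simp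
    moreover have "dist (vector [u, sqrt (c\<^sup>2 - u\<^sup>2)] :: real^2) (vector [0,0]) = c"
      using nn by (simp add: dist2 v)
    moreover have "dist (vector [0,0] :: real^2) (vector [a,0]) = a" using nn by (simp add: dist2)
    ultimately show ?thesis by blast
  qed
qed

text \<open>Stewart's theorem for the cevian from \<open>x\<close> to the point dividing \<open>p q\<close> in the ratio
  \<open>l : 1 - l\<close>.\<close>

lemma inner_stewart:
  fixes x p q :: "'b::real_inner"
  shows "(dist x ((1 - l) *\<^sub>R p + l *\<^sub>R q))\<^sup>2
     = (1 - l) * (dist x p)\<^sup>2 + l * (dist x q)\<^sup>2 - l * (1 - l) * (dist p q)\<^sup>2"
proof -
  have stewart: "((1-l) *\<^sub>R a + l *\<^sub>R b) \<bullet> ((1-l) *\<^sub>R a + l *\<^sub>R b)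
      = (1-l) * (a \<bullet> a) + l * (b \<bullet> b) - l * (1-l) * ((b-a) \<bullet> (b-a))" for a b :: 'b
    by (simp add: inner_diff inner_add inner_commute[of b a] field_simps)
  have "x - ((1 - l) *\<^sub>R p + l *\<^sub>R q) = (1-l) *\<^sub>R (x - p) + l *\<^sub>R (x - q)"
       "p - q = (x - q) - (x - p)"
    by (simp_all add: algebra_simps)
  then show ?thesis
    by (simp only: dist_norm power2_norm_eq_inner stewart)
qed

lemma geodesic_between_subsegment:
  assumes "geodesic I \<alpha>" "s \<in> I" "t \<in> I" "s \<le> t"
  shows "geodesic_between (\<alpha> s) (\<alpha> t) (\<lambda>u. \<alpha> (s + u))"
proof -
  have I: "{s..t} \<subseteq> I" using assms unfolding geodesic_def is_interval_1 by (meson atLeastAtMost_iff subsetI)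
  have "dist (\<alpha> s) (\<alpha> t) = t - s" using assms unfolding geodesic_def by auto
  moreover have "dist (\<alpha> (s + u)) (\<alpha> (s + v)) = \<bar>u - v\<bar>" if "u \<in> {0..t-s}" "v \<in> {0..t-s}" for u v
  proof -
    have "s + u \<in> I" "s + v \<in> I" using that I by auto
    then show ?thesis using assms(1) unfolding geodesic_def by (metis add_diff_cancel_left)
  qed
  ultimately show ?thesis unfolding geodesic_between_def geodesic_def
    by (auto simp: is_interval_cc)
qed

text \<open>The comparison axiom applied to a vertex and a point of the opposite side bounds the cevian
  by the Euclidean one, whose length is given by Stewart's theorem. All later metric estimates
  use the curvature bound only in this form.\<close>

lemma stewart_inequality:
  fixes \<alpha> :: "real \<Rightarrow> 'a::cat0_space"
  assumes geo: "geodesic I \<alpha>" and st: "s \<in> I" "t \<in> I" and l: "0 \<le> l" "l \<le> 1"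
  shows "(dist x (\<alpha> ((1 - l) * s + l * t)))\<^sup>2
     \<le> (1 - l) * (dist x (\<alpha> s))\<^sup>2 + l * (dist x (\<alpha> t))\<^sup>2 - l * (1 - l) * (t - s)\<^sup>2"
proof -
  have main: "(dist x (\<alpha> ((1 - l) * s + l * t)))\<^sup>2
     \<le> (1 - l) * (dist x (\<alpha> s))\<^sup>2 + l * (dist x (\<alpha> t))\<^sup>2 - l * (1 - l) * (t - s)\<^sup>2"
    if st: "s \<in> I" "t \<in> I" "s \<le> t" and l: "0 \<le> l" "l \<le> 1" for s t l
  proof -
    let ?p = "\<alpha> s" and ?q = "\<alpha> t"
    let ?\<alpha> = "\<lambda>u. \<alpha> (s + u)"
    have gpq: "geodesic_between ?p ?q ?\<alpha>" using geo st by (rule geodesic_between_subsegment)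
    have dpq: "dist ?p ?q = t - s" using geo st unfolding geodesic_def by auto
    obtain \<beta> where \<beta>: "geodesic_between ?q x \<beta>" using geodesic_between_exists by blast
    obtain \<delta> where \<delta>: "geodesic_between x ?p \<delta>" using geodesic_between_exists by blast
    obtain p' q' x' :: "real^2" where d: "dist p' q' = dist ?p ?q" "dist q' x' = dist ?q x"
        "dist x' p' = dist x ?p"
      using euclidean_comparison_triangle[of "dist ?p ?q" "dist ?q x" "dist x ?p"]
      by (metis dist_commute dist_triangle dist_triangle2 add.commute)
    let ?z = "?\<alpha> (l * (t - s))" and ?z' = "(1 - l) *\<^sub>R p' + l *\<^sub>R q'"
    have lst: "0 \<le> l * (t - s)" "l * (t - s) \<le> t - s"
      using l st by (auto intro: mult_left_le_one_le)
    have "dist p' ?z' = l * dist p' q'"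
    proof -
      have "p' - ?z' = l *\<^sub>R (p' - q')" by (simp add: algebra_simps)
      then show ?thesis using l by (simp add: dist_norm)
    qed
    moreover have "dist ?p ?z = l * (t - s)"
      using gpq lst unfolding geodesic_between_def geodesic_def dpq by force
    ultimately have c1: "comparison_point ?p ?q ?\<alpha> p' q' ?z ?z'"
      unfolding comparison_point_def using lst l d dpq by (auto simp: in_segment)
    have c2: "comparison_point ?q x \<beta> q' x' x x'"
      unfolding comparison_point_def using \<beta> d unfolding geodesic_between_def
      by (metis atLeastAtMost_iff ends_in_segment(2) imageI order_refl zero_le_dist)
    have "dist ?z x \<le> dist ?z' x'"
      using cat0_comparison[OF gpq \<beta> \<delta> d] c1 c2 by blast
    then have "(dist x ?z)\<^sup>2 \<le> (dist x' ?z')\<^sup>2" by (simp add: dist_commute power_mono)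
    also have "\<dots> = (1 - l) * (dist x ?p)\<^sup>2 + l * (dist x ?q)\<^sup>2 - l * (1 - l) * (t - s)\<^sup>2"
      using d dpq by (simp add: inner_stewart dist_commute)
    finally show ?thesis by (simp add: algebra_simps)
  qed
  show ?thesis
  proof (cases "s \<le> t")
    case True then show ?thesis using main st l by blast
  next
    case False
    then show ?thesis using main[of t s "1 - l"] st l
      by (simp add: algebra_simps power2_commute[of s t])
  qed
qed

text \<open>Let \<open>m\<close> be the midpoint of the diagonal \<open>x q\<close>. The Stewart inequality bounds the distances
  of \<open>y\<close> and \<open>p\<close> from \<open>m\<close>, and the other diagonal is at most the sum of these.\<close>

lemma quadrilateral_inequality:
  fixes x y p q :: "'a::cat0_space"
  shows "(dist x q)\<^sup>2 + (dist y p)\<^sup>2 \<le> (dist x y)\<^sup>2 + (dist y q)\<^sup>2 + (dist q p)\<^sup>2 + (dist p x)\<^sup>2"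
proof -
  obtain \<sigma> where \<sigma>: "geodesic_between x q \<sigma>" using geodesic_between_exists by blast
  let ?d = "dist x q"
  define m where "m = \<sigma> (?d / 2)"
  have mid: "(dist z m)\<^sup>2 \<le> (dist z x)\<^sup>2 / 2 + (dist z q)\<^sup>2 / 2 - ?d\<^sup>2 / 4" for z
    using stewart_inequality[of "{0..?d}" \<sigma> 0 ?d "1/2" z] \<sigma>
    unfolding geodesic_between_def m_def by (simp add: power2_eq_square)
  have "(dist y p)\<^sup>2 \<le> (dist y m + dist p m)\<^sup>2"
    by (intro power_mono dist_triangle2) simp
  also have "\<dots> \<le> 2 * (dist y m)\<^sup>2 + 2 * (dist p m)\<^sup>2"
    using sum_squares_bound[of "dist y m" "dist p m"] by (simp add: power2_sum)
  also have "\<dots> \<le> (dist y x)\<^sup>2 + (dist y q)\<^sup>2 + (dist p x)\<^sup>2 + (dist p q)\<^sup>2 - ?d\<^sup>2"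
    using mid[of y] mid[of p] by argo
  finally show ?thesis by (simp add: dist_commute)
qed

section \<open>Projection to a geodesic\<close>

text \<open>The parameter of the closest point. It turns membership in a curtain or a halfspace into an
  inequality between real numbers.\<close>

definition foot :: "real set \<Rightarrow> (real \<Rightarrow> 'a::metric_space) \<Rightarrow> 'a \<Rightarrow> real" where
  "foot I \<alpha> x = (THE t. t \<in> I \<and> closest_proj (\<alpha> ` I) x = \<alpha> t)"

text \<open>The part of \<^const>\<open>curtain_data\<close> that all curtains dual to one line share.\<close>

locale projecting_geodesic =
  fixes I :: "real set" and \<alpha> :: "real \<Rightarrow> 'a::cat0_space"
  assumes geodesic: "geodesic I \<alpha>"
    and unique_closest: "\<exists>!p. is_closest (\<alpha> ` I) x p"
begin

abbreviation proj_coord :: "'a \<Rightarrow> real" where "proj_coord \<equiv> foot I \<alpha>"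

lemma dist_on: "s \<in> I \<Longrightarrow> t \<in> I \<Longrightarrow> dist (\<alpha> s) (\<alpha> t) = \<bar>s - t\<bar>"
  using geodesic unfolding geodesic_def by blast

lemma inj: "inj_on \<alpha> I"
  by (rule inj_onI) (use dist_on in force)

lemma segment_subset: "s \<in> I \<Longrightarrow> t \<in> I \<Longrightarrow> {s..t} \<subseteq> I"
  using geodesic unfolding geodesic_def is_interval_1 by (meson atLeastAtMost_iff subsetI)

lemma is_closest_closest_proj: "is_closest (\<alpha> ` I) x (closest_proj (\<alpha> ` I) x)"
  unfolding closest_proj_def using unique_closest by (rule theI')

lemma foot: "proj_coord x \<in> I" "closest_proj (\<alpha> ` I) x = \<alpha> (proj_coord x)"
proof -
  have "\<exists>!t. t \<in> I \<and> closest_proj (\<alpha> ` I) x = \<alpha> t"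
    using is_closest_closest_proj[of x] inj unfolding is_closest_def inj_on_def by (metis imageE)
  from theI'[OF this] show "proj_coord x \<in> I" "closest_proj (\<alpha> ` I) x = \<alpha> (proj_coord x)"
    unfolding foot_def by blast+
qed

lemma dist_foot_le: "t \<in> I \<Longrightarrow> dist x (\<alpha> (proj_coord x)) \<le> dist x (\<alpha> t)"
  using is_closest_closest_proj[of x] unfolding is_closest_def foot by blast

lemma foot_eqI:
  assumes "t \<in> I" "\<And>s. s \<in> I \<Longrightarrow> dist x (\<alpha> t) \<le> dist x (\<alpha> s)"
  shows "proj_coord x = t"
proof -
  have "is_closest (\<alpha> ` I) x (\<alpha> t)" using assms unfolding is_closest_def by blast
  then have "closest_proj (\<alpha> ` I) x = \<alpha> t" using is_closest_closest_proj unique_closest by blast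
  then show ?thesis using foot[of x] assms(1) inj unfolding inj_on_def by metis
qed

lemma foot_on [simp]: "t \<in> I \<Longrightarrow> proj_coord (\<alpha> t) = t"
  by (rule foot_eqI) auto

text \<open>Moving a point towards its closest point does not change the latter. Curtains and
  halfspaces are therefore unions of geodesics that end on the line.\<close>

lemma foot_between:
  assumes "dist x z + dist z (\<alpha> (proj_coord x)) = dist x (\<alpha> (proj_coord x))"
  shows "proj_coord z = proj_coord x"
proof (rule foot_eqI)
  fix s assume "s \<in> I"
  from dist_foot_le[OF this, of x] show "dist z (\<alpha> (proj_coord x)) \<le> dist z (\<alpha> s)"
    using assms dist_triangle[of x "\<alpha> s" z] by linarith
qed (rule foot)

text \<open>Compare \<open>x\<close> with the point at ratio \<open>l\<close> between its closest point and \<open>\<alpha> t\<close>: minimality and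
  the Stewart inequality give the claim up to a factor \<open>1 - l\<close>, and \<open>l\<close> tends to \<open>0\<close>.\<close>

lemma pythagoras_inequality:
  assumes t: "t \<in> I"
  shows "(dist x (\<alpha> (proj_coord x)))\<^sup>2 + (t - proj_coord x)\<^sup>2 \<le> (dist x (\<alpha> t))\<^sup>2"
proof -
  define s where "s = proj_coord x"
  have s: "s \<in> I" by (simp add: s_def foot)
  define A where "A = (dist x (\<alpha> s))\<^sup>2"
  define B where "B = (dist x (\<alpha> t))\<^sup>2"
  define C where "C = (t - s)\<^sup>2"
  have *: "A + (1 - l) * C \<le> B" if l: "0 < l" "l < 1" for l
  proof -
    have "min s t \<le> (1 - l) * s + l * t" "(1 - l) * s + l * t \<le> max s t"
      using l convex_bound_le[of s "max s t" t "1-l" l] convex_bound_le[of "-s" "- min s t" "-t" "1-l" l]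
      by auto
    then have u: "(1 - l) * s + l * t \<in> I"
      using s t segment_subset[of "min s t" "max s t"] by (auto simp: min_def max_def split: if_splits)
    have "A \<le> (dist x (\<alpha> ((1 - l) * s + l * t)))\<^sup>2"
      unfolding A_def using dist_foot_le[OF u, of x] by (simp add: s_def power_mono)
    also have "\<dots> \<le> (1 - l) * A + l * B - l * (1 - l) * C"
      unfolding A_def B_def C_def using l by (intro stewart_inequality[OF geodesic s t]) auto
    finally have "l * (A + (1 - l) * C) \<le> l * B" by (simp add: algebra_simps)
    then show ?thesis using l by simp
  qed
  have "((\<lambda>l. A + (1 - l) * C) \<longlongrightarrow> A + (1 - 0) * C) (at_right 0)"
    by (intro tendsto_intros)
  moreover have "\<forall>\<^sub>F l in at_right 0. A + (1 - l) * C \<le> B"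
    by (rule eventually_mono[OF eventually_at_right_real[of 0 1]]) (use * in auto)
  ultimately have "A + (1 - 0) * C \<le> B" by (rule tendsto_upperbound) simp
  then show ?thesis by (simp add: A_def B_def C_def s_def)
qed

text \<open>Add the Pythagoras inequalities of \<open>x\<close> and \<open>y\<close>, each with the closest point of the other,
  to the inequality for the quadrilateral that \<open>x\<close>, \<open>y\<close> and their closest points form.\<close>

lemma foot_lipschitz: "\<bar>proj_coord x - proj_coord y\<bar> \<le> dist x y"
proof -
  let ?s = "proj_coord x" and ?t = "proj_coord y"
  have "(dist x (\<alpha> ?s))\<^sup>2 + (?t - ?s)\<^sup>2 \<le> (dist x (\<alpha> ?t))\<^sup>2"
       "(dist y (\<alpha> ?t))\<^sup>2 + (?s - ?t)\<^sup>2 \<le> (dist y (\<alpha> ?s))\<^sup>2"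
    using foot by (auto intro: pythagoras_inequality)
  moreover have "(dist (\<alpha> ?t) (\<alpha> ?s))\<^sup>2 = (?s - ?t)\<^sup>2" using foot by (simp add: dist_on power2_commute)
  ultimately have "(?s - ?t)\<^sup>2 \<le> (dist x y)\<^sup>2"
    using quadrilateral_inequality[of x "\<alpha> ?t" y "\<alpha> ?s"]
    by (simp add: dist_commute power2_commute[of ?t ?s])
  then show ?thesis by (metis abs_of_nonneg power2_le_iff_abs_le zero_le_dist)
qed

lemma continuous_on_foot: "continuous_on A proj_coord"
  unfolding continuous_on_iff dist_real_def using foot_lipschitz
  by (metis dist_commute order_le_less_trans)

lemma mem_curtain_iff:
  assumes "{r - 1/2..r + 1/2} \<subseteq> I"
  shows "x \<in> curtain I \<alpha> r \<longleftrightarrow> r - 1/2 \<le> proj_coord x \<and> proj_coord x \<le> r + 1/2"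
proof -
  have "x \<in> curtain I \<alpha> r \<longleftrightarrow> \<alpha> (proj_coord x) \<in> \<alpha> ` {r - 1/2..r + 1/2}"
    by (simp add: curtain_def foot)
  also have "\<dots> \<longleftrightarrow> proj_coord x \<in> {r - 1/2..r + 1/2}"
    using inj foot(1) assms by (rule inj_on_image_mem_iff)
  finally show ?thesis by simp
qed

lemma mem_halfspace_minus_iff: "x \<in> halfspace_minus I \<alpha> r \<longleftrightarrow> proj_coord x < r - 1/2"
  using inj_on_image_mem_iff[OF inj foot(1), of "I \<inter> {..<r - 1/2}" x] foot[of x]
  by (simp add: halfspace_minus_def)

lemma mem_halfspace_plus_iff: "x \<in> halfspace_plus I \<alpha> r \<longleftrightarrow> r + 1/2 < proj_coord x"
  using inj_on_image_mem_iff[OF inj foot(1), of "I \<inter> {r + 1/2<..}" x] foot[of x]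
  by (simp add: halfspace_plus_def)

end

lemma curtain_dataD:
  assumes "curtain_data I (\<alpha> :: real \<Rightarrow> 'a::cat0_space) r"
  shows "projecting_geodesic I \<alpha>" "{r - 1/2..r + 1/2} \<subseteq> I"
  using assms interior_subset unfolding curtain_data_def projecting_geodesic_def by blast+

lemma curtain_dataI_line:
  assumes "projecting_geodesic UNIV (\<alpha> :: real \<Rightarrow> 'a::cat0_space)"
  shows "curtain_data UNIV \<alpha> r"
  using assms unfolding curtain_data_def projecting_geodesic_def by simp

text \<open>The line is a copy of \<open>\<real>\<close>, so a closest point exists by compactness although the ambient
  space may be incomplete. Of two closest points, the Stewart inequality makes the midpoint
  closer.\<close>

lemma projecting_geodesic_line:
  fixes \<gamma> :: "real \<Rightarrow> 'a::cat0_space"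
  assumes geo: "geodesic UNIV \<gamma>"
  shows "projecting_geodesic UNIV \<gamma>"
proof
  fix x
  have d: "dist (\<gamma> s) (\<gamma> t) = \<bar>s - t\<bar>" for s t using geo unfolding geodesic_def by blast
  define T where "T = 2 * dist x (\<gamma> 0)"
  have "continuous_on {-T..T} \<gamma>" unfolding continuous_on_iff d dist_real_def by auto
  then have "continuous_on {-T..T} (\<lambda>t. dist x (\<gamma> t))" by (intro continuous_intros)
  then obtain t where t: "t \<in> {-T..T}" "\<And>s. s \<in> {-T..T} \<Longrightarrow> dist x (\<gamma> t) \<le> dist x (\<gamma> s)"
    using continuous_attains_inf[of "{-T..T}" "\<lambda>t. dist x (\<gamma> t)"] by (auto simp: T_def)
  have min: "dist x (\<gamma> t) \<le> dist x (\<gamma> s)" for s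
  proof (cases "s \<in> {-T..T}")
    case False
    then have "\<bar>s\<bar> > T" by auto
    then have "dist x (\<gamma> s) \<ge> dist x (\<gamma> 0)"
      using dist_triangle2[of "\<gamma> s" "\<gamma> 0" x] d[of s 0] by (simp add: T_def dist_commute)
    moreover have "dist x (\<gamma> t) \<le> dist x (\<gamma> 0)" by (rule t(2)) (simp add: T_def)
    ultimately show ?thesis by linarith
  qed (use t in blast)
  have "s = t" if "\<And>u. dist x (\<gamma> s) \<le> dist x (\<gamma> u)" for s
  proof -
    have e: "dist x (\<gamma> s) = dist x (\<gamma> t)" using that min by (simp add: order_antisym)
    let ?m = "(1 - 1/2) * s + 1/2 * t"
    have "(dist x (\<gamma> s))\<^sup>2 \<le> (dist x (\<gamma> ?m))\<^sup>2" using that by (simp add: power_mono)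
    also have "\<dots> \<le> (dist x (\<gamma> s))\<^sup>2 - (t - s)\<^sup>2 / 4"
      using stewart_inequality[OF geo, of s t "1/2" x] e by simp
    finally show ?thesis by simp
  qed
  then show "\<exists>!p. is_closest (range \<gamma>) x p"
    unfolding is_closest_def using min by (intro ex1I[of _ "\<gamma> t"]) auto
qed (rule geo)

lemma (in projecting_geodesic) foot_translation:
  assumes UNIV: "I = UNIV" and iso: "\<And>p q. dist (a p) (a q) = dist p q" and a: "\<And>t. a (\<alpha> t) = \<alpha> (t + c)"
  shows "proj_coord (a x) = proj_coord x + c"
proof (rule foot_eqI)
  fix s
  have "dist x (\<alpha> (proj_coord x)) \<le> dist x (\<alpha> (s - c))" by (rule dist_foot_le) (simp add: UNIV)
  then show "dist (a x) (\<alpha> (proj_coord x + c)) \<le> dist (a x) (\<alpha> s)"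
    using iso[of x "\<alpha> (proj_coord x)"] iso[of x "\<alpha> (s - c)"] by (simp add: a)
qed (simp add: UNIV)

section \<open>Disjoint curtains separating two points\<close>

text \<open>Take the last zero \<open>s\<close> of \<open>f - a\<close>, and then the first zero \<open>t\<close> of \<open>f - b\<close> after \<open>s\<close>.\<close>

lemma crossing_interval:
  fixes f :: "real \<Rightarrow> real"
  assumes cont: "continuous_on {0..l} f" and l: "0 \<le> l" and ends: "f 0 \<le> a" "b \<le> f l" and ab: "a < b"
  obtains s t where "0 \<le> s" "s < t" "t \<le> l" "f s = a" "f t = b" "\<And>u. u \<in> {s..t} \<Longrightarrow> f u \<in> {a..b}"
proof -
  have compact: "compact {u \<in> {p..q}. f u = z}" if "{p..q} \<subseteq> {0..l}" for p q z
  proof -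
    have "closed {u \<in> {p..q}. f u = z}"
      using continuous_on_subset[OF cont that] by (rule continuous_closed_preimage_constant) simp
    moreover have "bounded {u \<in> {p..q}. f u = z}" by (rule bounded_subset[of "{p..q}"]) auto
    ultimately show ?thesis by (simp add: compact_eq_bounded_closed)
  qed
  have ivt: "\<exists>u. p \<le> u \<and> u \<le> q \<and> f u = z" if "f p \<le> z" "z \<le> f q" "p \<le> q" "{p..q} \<subseteq> {0..l}" for p q z
    using that(1-3) continuous_on_subset[OF cont that(4)] by (rule IVT')
  have "{u \<in> {0..l}. f u = a} \<noteq> {}" using ivt[of 0 a l] ends ab l by auto
  then obtain s where s: "s \<in> {0..l}" "f s = a" and s_max: "\<And>u. u \<in> {0..l} \<Longrightarrow> f u = a \<Longrightarrow> u \<le> s"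
    using compact_attains_sup[OF compact[of 0 l a]] by auto
  have "{u \<in> {s..l}. f u = b} \<noteq> {}" using ivt[of s b l] ends ab s by auto
  then obtain t where t: "t \<in> {s..l}" "f t = b" and t_min: "\<And>u. u \<in> {s..l} \<Longrightarrow> f u = b \<Longrightarrow> t \<le> u"
    using compact_attains_inf[OF compact[of s l b]] s by auto
  have "f u \<in> {a..b}" if u: "u \<in> {s..t}" for u
  proof -
    have "a \<le> f u"
    proof (rule ccontr)
      assume less: "\<not> a \<le> f u"
      then obtain v where "u \<le> v" "v \<le> l" "f v = a" using ivt[of u a l] u s t ends ab by auto
      moreover from this have "v \<le> s" using s_max[of v] u s by auto
      ultimately have "u = s" using u by (intro order_antisym) auto
      then show False using s less by simp
    qed
    moreover have "f u \<le> b"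
    proof (rule ccontr)
      assume less: "\<not> f u \<le> b"
      then obtain v where "s \<le> v" "v \<le> u" "f v = b" using ivt[of s b u] u s t ends ab by auto
      moreover from this have "t \<le> v" using t_min[of v] u t by auto
      ultimately have "u = t" using u by (intro order_antisym) auto
      then show False using t less by simp
    qed
    ultimately show ?thesis by simp
  qed
  moreover have "s \<noteq> t" using s t ab by auto
  ultimately show thesis using s t by (intro that[of s t]) auto
qed

lemma chainE:
  assumes "chain c"
  obtains J h where "c = h ` J"
    and "\<And>i j k. i \<in> J \<Longrightarrow> k \<in> J \<Longrightarrow> i \<le> j \<Longrightarrow> j \<le> k \<Longrightarrow> j \<in> J"
    and "\<And>i. i \<in> J \<Longrightarrow> is_curtain (h i)"
    and "\<And>i j. i \<in> J \<Longrightarrow> j \<in> J \<Longrightarrow> i \<noteq> j \<Longrightarrow> h i \<inter> h j = {}"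
    and "\<And>i :: int. {i - 1, i, i + 1} \<subseteq> J \<Longrightarrow> separates (h i) (h (i - 1)) (h (i + 1))"
proof -
  from assms obtain J h where *: "c = h ` J" "\<forall>i\<in>J. \<forall>k\<in>J. {i..k} \<subseteq> J" "\<forall>i\<in>J. is_curtain (h i)"
      "\<forall>i\<in>J. \<forall>j\<in>J. i \<noteq> j \<longrightarrow> h i \<inter> h j = {}"
      "\<forall>i::int. {i - 1, i, i + 1} \<subseteq> J \<longrightarrow> separates (h i) (h (i - 1)) (h (i + 1))"
    unfolding chain_def by (elim exE conjE) blast
  show thesis
  proof (rule that[OF *(1)])
    show "j \<in> J" if "i \<in> J" "k \<in> J" "i \<le> j" "j \<le> k" for i j k
      using *(2) that by (meson atLeastAtMost_iff subsetD)
  next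
    show "is_curtain (h i)" if "i \<in> J" for i using *(3) that by simp
  next
    show "h i \<inter> h j = {}" if "i \<in> J" "j \<in> J" "i \<noteq> j" for i j using *(4) that by simp
  next
    show "separates (h i) (h (i - 1)) (h (i + 1))" if "{i - 1, i, i + 1} \<subseteq> J" for i
      using *(5) that by simp
  qed
qed

lemma chain_elements_disjoint:
  assumes "chain c" "h \<in> c" "k \<in> c" "h \<noteq> k"
  shows "h \<inter> k = {}"
proof (rule chainE[OF assms(1)])
  fix J :: "int set" and g
  assume "c = g ` J" and disj: "\<And>i j. i \<in> J \<Longrightarrow> j \<in> J \<Longrightarrow> i \<noteq> j \<Longrightarrow> g i \<inter> g j = {}"
  from this(1) obtain i j where "h = g i" "k = g j" "i \<in> J" "j \<in> J" using assms(2,3) by blast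
  then show ?thesis using disj[of i j] assms(4) by auto
qed

lemma separates_commute: "separates h A B \<longleftrightarrow> separates h B A"
  unfolding separates_def by (simp only: disj_commute)

text \<open>A curtain has width at least one: along the geodesic, the foot on the line to which the
  curtain is dual has to cross an interval of length one, and it moves at speed at most one.\<close>

lemma curtain_contains_unit_segment:
  fixes x y :: "'a::cat0_space"
  assumes sep: "separates h {x} {y}" and \<sigma>: "geodesic_between x y \<sigma>"
  shows "\<exists>s. 0 \<le> s \<and> s + 1 \<le> dist x y \<and> \<sigma> ` {s..s+1} \<subseteq> h"
proof -
  obtain I \<alpha> r where \<alpha>: "curtain_data I \<alpha> r" "h = curtain I \<alpha> r"
    and xy: "x \<in> halfspace_minus I \<alpha> r \<and> y \<in> halfspace_plus I \<alpha> r \<or>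
        y \<in> halfspace_minus I \<alpha> r \<and> x \<in> halfspace_plus I \<alpha> r"
    using sep unfolding separates_def by blast
  interpret projecting_geodesic I \<alpha> using \<alpha>(1) by (rule curtain_dataD)
  note mem = mem_curtain_iff[OF curtain_dataD(2)[OF \<alpha>(1)]] mem_halfspace_minus_iff mem_halfspace_plus_iff
  let ?l = "dist x y"
  have \<sigma>: "\<And>s t. s \<in> {0..?l} \<Longrightarrow> t \<in> {0..?l} \<Longrightarrow> dist (\<sigma> s) (\<sigma> t) = \<bar>s - t\<bar>" "\<sigma> 0 = x" "\<sigma> ?l = y"
    using \<sigma> unfolding geodesic_between_def geodesic_def by blast+
  \<comment> \<open>The sign \<open>e\<close> orients the dual line so that the foot increases from \<open>x\<close> to \<open>y\<close>.\<close>
  obtain e :: real where e: "\<bar>e\<bar> = 1" "e * proj_coord x \<le> e * r - 1/2" "e * r + 1/2 \<le> e * proj_coord y"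
    using xy unfolding mem
  proof
    assume "proj_coord x < r - 1/2 \<and> r + 1/2 < proj_coord y"
    then show thesis by (intro that[of 1]) auto
  next
    assume "proj_coord y < r - 1/2 \<and> r + 1/2 < proj_coord x"
    then show thesis by (intro that[of "-1"]) auto
  qed
  define f where "f = (\<lambda>t. e * proj_coord (\<sigma> t))"
  have lip: "\<bar>f s - f t\<bar> \<le> \<bar>s - t\<bar>" if "s \<in> {0..?l}" "t \<in> {0..?l}" for s t
    using foot_lipschitz[of "\<sigma> s" "\<sigma> t"] \<sigma>(1)[OF that] e(1)
    by (simp add: f_def abs_mult flip: right_diff_distrib)
  then have "continuous_on {0..?l} f"
    unfolding continuous_on_iff dist_real_def by (meson order_le_less_trans)
  moreover have "f 0 \<le> e * r - 1/2" "e * r + 1/2 \<le> f ?l" using e by (auto simp: f_def \<sigma>)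
  ultimately obtain s t where st: "0 \<le> s" "s < t" "t \<le> ?l" "f s = e * r - 1/2" "f t = e * r + 1/2"
      "\<And>u. u \<in> {s..t} \<Longrightarrow> f u \<in> {e * r - 1/2..e * r + 1/2}"
    using crossing_interval[of ?l f "e * r - 1/2" "e * r + 1/2"] by auto
  have "1 \<le> t - s" using lip[of s t] st by auto
  moreover have "\<sigma> u \<in> h" if "u \<in> {s..s+1}" for u
  proof -
    have "\<bar>e * (proj_coord (\<sigma> u) - r)\<bar> \<le> 1/2"
      using st(6)[of u] that \<open>1 \<le> t - s\<close> unfolding abs_le_iff by (auto simp: f_def algebra_simps)
    then have "\<bar>proj_coord (\<sigma> u) - r\<bar> \<le> 1/2" using e(1) by (simp add: abs_mult)
    then show ?thesis unfolding \<alpha>(2) mem by (simp only: abs_le_iff) linarith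
  qed
  ultimately show ?thesis using st by (intro exI[of _ s]) auto
qed

text \<open>The curtains cut disjoint segments of unit length out of a geodesic from \<open>x\<close> to \<open>y\<close>, and
  disjoint closed unit intervals have different integer parts of their left ends.\<close>

lemma card_disjoint_separating_le:
  fixes x y :: "'a::cat0_space"
  assumes sep: "\<And>h. h \<in> F \<Longrightarrow> separates h {x} {y}"
    and disj: "\<And>h k. h \<in> F \<Longrightarrow> k \<in> F \<Longrightarrow> h \<noteq> k \<Longrightarrow> h \<inter> k = {}"
  shows "real (card F) \<le> dist x y"
proof -
  obtain \<sigma> where \<sigma>: "geodesic_between x y \<sigma>" using geodesic_between_exists by blast
  define P where "P h s \<longleftrightarrow> 0 \<le> s \<and> s + 1 \<le> dist x y \<and> \<sigma> ` {s..s+1} \<subseteq> h" for h s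
  have "\<forall>h\<in>F. \<exists>s. P h s" unfolding P_def using curtain_contains_unit_segment[OF sep \<sigma>] by blast
  then obtain s where "\<forall>h\<in>F. P h (s h)" by metis
  then have s: "0 \<le> s h" "s h + 1 \<le> dist x y" "\<sigma> ` {s h..s h+1} \<subseteq> h" if "h \<in> F" for h
    using that unfolding P_def by auto
  have inj: "inj_on (\<lambda>h. \<lfloor>s h\<rfloor>) F"
  proof (rule inj_onI, rule ccontr)
    fix h k assume hk: "h \<in> F" "k \<in> F" "\<lfloor>s h\<rfloor> = \<lfloor>s k\<rfloor>" "h \<noteq> k"
    then have "max (s h) (s k) \<in> {s h..s h+1}" "max (s h) (s k) \<in> {s k..s k+1}"
      by (simp_all add: max_def) linarith+
    then have "\<sigma> (max (s h) (s k)) \<in> h \<inter> k" using s(3) hk by blast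
    then show False using disj hk by blast
  qed
  have "(\<lambda>h. \<lfloor>s h\<rfloor>) ` F \<subseteq> {0..<\<lfloor>dist x y\<rfloor>}"
  proof (rule image_subsetI)
    fix h assume "h \<in> F"
    from s(1,2)[OF this] show "\<lfloor>s h\<rfloor> \<in> {0..<\<lfloor>dist x y\<rfloor>}" by simp linarith
  qed
  then have "card F \<le> card {0..<\<lfloor>dist x y\<rfloor>}" using inj by (intro card_inj_on_le[where f="\<lambda>h. \<lfloor>s h\<rfloor>"]) auto
  then have "card F \<le> nat \<lfloor>dist x y\<rfloor>" by simp
  then show ?thesis using of_nat_floor[OF zero_le_dist, of x y] by linarith
qed

section \<open>Nested sides along a chain\<close>

context projecting_geodesic
begin

lemma continuous_on_geodesic: "continuous_on I \<alpha>"
  unfolding continuous_on_iff dist_real_def by (metis dist_on)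

text \<open>Every point of the set is joined inside the set to the piece \<open>\<alpha> ` (S \<inter> I)\<close> of the line, by the
  geodesic to its closest point.\<close>

lemma connected_foot_vimage:
  assumes S: "is_interval S"
  shows "connected (proj_coord -` S)"
proof -
  have "is_interval (S \<inter> I)" using S geodesic unfolding geodesic_def by (simp add: is_interval_Int)
  then have K: "connected (\<alpha> ` (S \<inter> I))"
    by (intro connected_continuous_image continuous_on_subset[OF continuous_on_geodesic])
      (auto simp: is_interval_connected_1)
  have "\<exists>C. connected C \<and> x \<in> C \<and> \<alpha> ` (S \<inter> I) \<subseteq> C \<and> C \<subseteq> proj_coord -` S"
    if x: "x \<in> proj_coord -` S" for x
  proof -
    define p where "p = \<alpha> (proj_coord x)"
    obtain \<sigma> where \<sigma>: "geodesic_between x p \<sigma>" using geodesic_between_exists by blast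
    let ?l = "dist x p"
    have d: "\<And>s t. s \<in> {0..?l} \<Longrightarrow> t \<in> {0..?l} \<Longrightarrow> dist (\<sigma> s) (\<sigma> t) = \<bar>s - t\<bar>" "\<sigma> 0 = x" "\<sigma> ?l = p"
      using \<sigma> unfolding geodesic_between_def geodesic_def by blast+
    have "continuous_on {0..?l} \<sigma>" unfolding continuous_on_iff dist_real_def by (metis d(1))
    then have conn: "connected (\<sigma> ` {0..?l})" by (intro connected_continuous_image) auto
    have "p \<in> \<sigma> ` {0..?l}" using d(3) by (intro image_eqI[of _ _ ?l]) auto
    moreover have "p \<in> \<alpha> ` (S \<inter> I)" using x foot by (auto simp: p_def)
    ultimately have "connected (\<sigma> ` {0..?l} \<union> \<alpha> ` (S \<inter> I))"
      by (intro connected_Un conn K) auto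
    moreover have "\<sigma> t \<in> proj_coord -` S" if "t \<in> {0..?l}" for t
    proof -
      have "dist x (\<sigma> t) + dist (\<sigma> t) p = dist x p"
        using d(1)[of 0 t] d(1)[of t ?l] d(2,3) that by simp
      then have "proj_coord (\<sigma> t) = proj_coord x" unfolding p_def by (rule foot_between)
      then show ?thesis using x by simp
    qed
    moreover have "x \<in> \<sigma> ` {0..?l}" using d(2) by (intro image_eqI[of _ _ 0]) auto
    ultimately show ?thesis by (intro exI[of _ "\<sigma> ` {0..?l} \<union> \<alpha> ` (S \<inter> I)"]) auto
  qed
  then obtain C where C: "\<And>x. x \<in> proj_coord -` S \<Longrightarrow>
      connected (C x) \<and> x \<in> C x \<and> \<alpha> ` (S \<inter> I) \<subseteq> C x \<and> C x \<subseteq> proj_coord -` S"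
    by metis
  show ?thesis
  proof (cases "proj_coord -` S = {}")
    case False
    then have "S \<inter> I \<noteq> {}" using foot by auto
    then have "connected (\<Union>(C ` (proj_coord -` S)))"
      using C by (intro connected_Union) (auto, blast)
    moreover have "\<Union>(C ` (proj_coord -` S)) = proj_coord -` S" using C by blast
    ultimately show ?thesis by simp
  qed simp
qed

end

lemma curtain_nonempty: "is_curtain (h :: 'a::cat0_space set) \<Longrightarrow> h \<noteq> {}"
proof -
  assume "is_curtain h"
  then obtain I \<alpha> r where *: "curtain_data I \<alpha> r" "h = curtain I \<alpha> r" unfolding is_curtain_def by blast
  interpret projecting_geodesic I \<alpha> using *(1) by (rule curtain_dataD)
  have sub: "{r - 1/2..r + 1/2} \<subseteq> I" using *(1) by (rule curtain_dataD)
  then have "proj_coord (\<alpha> r) = r" by (intro foot_on) auto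
  then have "\<alpha> r \<in> h" unfolding *(2) mem_curtain_iff[OF sub] by simp
  then show ?thesis by blast
qed

text \<open>The topological content of separation, free of the particular line to which the curtain is
  dual. Neighbouring elements of a chain come with unrelated lines, so only this form can be
  compared along a chain.\<close>

lemma separates_sides:
  fixes h :: "'a::cat0_space set"
  assumes "separates h A B"
  shows "\<exists>U V. A \<subseteq> U \<and> B \<subseteq> V \<and> open U \<and> open V \<and> U \<inter> V = {} \<and> - h = U \<union> V \<and>
    connected (U \<union> h) \<and> connected (V \<union> h) \<and> (\<forall>P Q. P \<subseteq> U \<longrightarrow> Q \<subseteq> V \<longrightarrow> separates h P Q)"
proof -
  obtain I \<alpha> r where \<alpha>: "curtain_data I \<alpha> r" "h = curtain I \<alpha> r"
    and AB: "A \<subseteq> halfspace_minus I \<alpha> r \<and> B \<subseteq> halfspace_plus I \<alpha> r \<or>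
        B \<subseteq> halfspace_minus I \<alpha> r \<and> A \<subseteq> halfspace_plus I \<alpha> r"
    using assms unfolding separates_def by blast
  interpret projecting_geodesic I \<alpha> using \<alpha>(1) by (rule curtain_dataD)
  note mem = mem_curtain_iff[OF curtain_dataD(2)[OF \<alpha>(1)]] mem_halfspace_minus_iff mem_halfspace_plus_iff
  let ?M = "halfspace_minus I \<alpha> r" and ?P = "halfspace_plus I \<alpha> r"
  have sets: "?M = proj_coord -` {..<r - 1/2}" "?P = proj_coord -` {r + 1/2<..}"
      "?M \<union> h = proj_coord -` {..r + 1/2}" "?P \<union> h = proj_coord -` {r - 1/2..}"
    unfolding \<alpha>(2) by (auto simp: mem)
  have "open ?M" "open ?P" unfolding sets
    by (auto intro: open_vimage simp: continuous_on_foot)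
  moreover have "connected (?M \<union> h)" "connected (?P \<union> h)" unfolding sets(3,4)
    by (auto intro!: connected_foot_vimage simp: is_interval_ic is_interval_ci)
  moreover have "?M \<inter> ?P = {}" "- h = ?M \<union> ?P" unfolding \<alpha>(2) by (auto simp: mem)
  ultimately have top: "open ?M \<and> open ?P \<and> connected (?M \<union> h) \<and> connected (?P \<union> h) \<and>
      ?M \<inter> ?P = {} \<and> - h = ?M \<union> ?P"
    by blast
  have sep: "separates h P Q" if "P \<subseteq> ?M \<and> Q \<subseteq> ?P \<or> Q \<subseteq> ?M \<and> P \<subseteq> ?P" for P Q
    unfolding separates_def using \<alpha> that by blast
  from AB show ?thesis
  proof
    assume "A \<subseteq> ?M \<and> B \<subseteq> ?P"
    then show ?thesis using top sep by (intro exI[of _ ?M] exI[of _ ?P]) simp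
  next
    assume "B \<subseteq> ?M \<and> A \<subseteq> ?P"
    then show ?thesis using top sep by (intro exI[of _ ?P] exI[of _ ?M]) (simp add: Int_commute Un_commute)
  qed
qed

text \<open>The set \<open>U j \<union> h j\<close> is connected, misses \<open>h (j + 1)\<close>, and contains \<open>h j\<close>, which lies in
  \<open>U (j + 1)\<close>. It is therefore contained in \<open>U (j + 1)\<close>, and the sides increase along the
  sequence.\<close>

lemma sides_nested:
  fixes h U V :: "nat \<Rightarrow> 'b::topological_space set"
  assumes ne: "\<And>i. 0 < i \<Longrightarrow> i < n \<Longrightarrow> h i \<noteq> {}"
    and op: "\<And>i. 0 < i \<Longrightarrow> i < n \<Longrightarrow> open (U i) \<and> open (V i)"
    and sides: "\<And>i. 0 < i \<Longrightarrow> i < n \<Longrightarrow> U i \<inter> V i = {} \<and> - h i = U i \<union> V i"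
    and conn: "\<And>i. 0 < i \<Longrightarrow> i < n \<Longrightarrow> connected (U i \<union> h i)"
    and prev: "\<And>i. 0 < i \<Longrightarrow> i < n \<Longrightarrow> h (i - 1) \<subseteq> U i"
    and succ: "\<And>i. 0 < i \<Longrightarrow> i < n \<Longrightarrow> h (i + 1) \<subseteq> V i"
  shows "0 < j \<Longrightarrow> j < n \<Longrightarrow> h 0 \<subseteq> U j"
proof (induction j)
  case (Suc j)
  show ?case
  proof (cases "j = 0")
    case True then show ?thesis using prev[of "Suc j"] Suc.prems by simp
  next
    case False
    then have j: "0 < j" "j < n" "0 < Suc j" using Suc.prems by auto
    have disj: "(U j \<union> h j) \<inter> h (Suc j) = {}" using succ[OF j(1,2)] sides[OF j(1,2)] by auto
    have "U (Suc j) \<inter> (U j \<union> h j) = {} \<or> V (Suc j) \<inter> (U j \<union> h j) = {}"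
      by (rule connectedD[OF conn[OF j(1,2)]])
        (use op[OF j(3) Suc.prems(2)] sides[OF j(3) Suc.prems(2)] disj in auto)
    moreover have "h j \<subseteq> U (Suc j)" using prev[OF j(3) Suc.prems(2)] by simp
    ultimately have "V (Suc j) \<inter> (U j \<union> h j) = {}" using ne[OF j(1,2)] by auto
    then have "U j \<subseteq> U (Suc j)" using sides[OF j(3) Suc.prems(2)] disj by auto
    then show ?thesis using Suc.IH j by auto
  qed
qed simp

text \<open>A chain only prescribes how an element separates its two neighbours. Nesting the sides in
  both directions extends this to the ends of the chain.\<close>

lemma chain_separates_ends:
  fixes h :: "nat \<Rightarrow> 'a::cat0_space set"
  assumes cur: "\<And>i. i \<le> n \<Longrightarrow> is_curtain (h i)"
    and sep: "\<And>i. 0 < i \<Longrightarrow> i < n \<Longrightarrow> separates (h i) (h (i - 1)) (h (i + 1))"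
    and j: "0 < j" "j < n"
  shows "separates (h j) (h 0) (h n)"
proof -
  let ?S = "\<lambda>i U V. h (i-1) \<subseteq> U \<and> h (i+1) \<subseteq> V \<and> open U \<and> open V \<and> U \<inter> V = {} \<and> - h i = U \<union> V \<and>
    connected (U \<union> h i) \<and> connected (V \<union> h i) \<and> (\<forall>P Q. P \<subseteq> U \<longrightarrow> Q \<subseteq> V \<longrightarrow> separates (h i) P Q)"
  have "\<forall>i. \<exists>U V. 0 < i \<and> i < n \<longrightarrow> ?S i U V" using separates_sides[OF sep] by meson
  then obtain U V where UV: "\<And>i. 0 < i \<Longrightarrow> i < n \<Longrightarrow> ?S i (U i) (V i)" by metis
  have ne: "h i \<noteq> {}" if "i \<le> n" for i using curtain_nonempty[OF cur[OF that]] .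
  have "h 0 \<subseteq> U j"
    by (rule sides_nested[of n h U V]) (use UV ne j in auto)
  \<comment> \<open>The same statement for the reversed sequence, in which the two sides are exchanged.\<close>
  moreover have "h (n - 0) \<subseteq> V (n - (n - j))"
  proof (rule sides_nested[of n "\<lambda>i. h (n - i)" "\<lambda>i. V (n - i)" "\<lambda>i. U (n - i)"])
    fix i assume i: "0 < i" "i < n"
    then have *: "0 < n - i" "n - i < n" "n - (i - 1) = n - i + 1" "n - (i + 1) = n - i - 1" by auto
    note S = UV[OF *(1,2)]
    show "h (n - i) \<noteq> {}" using ne by simp
    show "open (V (n - i)) \<and> open (U (n - i))" "connected (V (n - i) \<union> h (n - i))" using S by auto
    show "V (n - i) \<inter> U (n - i) = {} \<and> - h (n - i) = V (n - i) \<union> U (n - i)" using S by auto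
    show "h (n - (i - 1)) \<subseteq> V (n - i)" "h (n - (i + 1)) \<subseteq> U (n - i)" using S unfolding * by auto
  qed (use j in auto)
  ultimately show ?thesis using UV[OF j] j by auto
qed

text \<open>A larger chain has \<open>m + 3\<close> consecutive elements. The first and the last of them contain points of
  \<open>W\<close>, and the \<open>m + 1\<close> elements in between separate these points, which are at distance at most
  \<open>m\<close>.\<close>

lemma chain_meeting_bounded_set:
  fixes c :: "'a::cat0_space set set"
  assumes c: "chain c" and meet: "\<And>k. k \<in> c \<Longrightarrow> k \<inter> W \<noteq> {}"
    and W: "\<And>u v. u \<in> W \<Longrightarrow> v \<in> W \<Longrightarrow> dist u v \<le> real m"
  shows "finite c \<and> card c \<le> m + 2"
proof (rule ccontr)
  assume big: "\<not> (finite c \<and> card c \<le> m + 2)"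
  obtain F where F: "F \<subseteq> c" "finite F" "card F = m + 3"
  proof (cases "finite c")
    case True
    then have "m + 3 \<le> card c" using big by auto
    then show thesis using obtain_subset_with_card_n that by metis
  next
    case False then show thesis using infinite_arbitrarily_large that by metis
  qed
  from c show False
  proof (rule chainE)
    fix J h
    assume h: "c = h ` J"
      and J: "\<And>i j k. i \<in> J \<Longrightarrow> k \<in> J \<Longrightarrow> i \<le> j \<Longrightarrow> j \<le> k \<Longrightarrow> j \<in> J"
      and cur: "\<And>i. i \<in> J \<Longrightarrow> is_curtain (h i)"
      and disj: "\<And>i j. i \<in> J \<Longrightarrow> j \<in> J \<Longrightarrow> i \<noteq> j \<Longrightarrow> h i \<inter> h j = {}"
      and sep: "\<And>i :: int. {i - 1, i, i + 1} \<subseteq> J \<Longrightarrow> separates (h i) (h (i - 1)) (h (i + 1))"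
    obtain T where T: "T \<subseteq> J" "inj_on h T" "F = h ` T" using F(1) unfolding h subset_image_inj by blast
    then have "finite T" "card T = m + 3" using F by (auto simp: card_image finite_image_iff)
    then have "T \<noteq> {}" by auto
    \<comment> \<open>Indices of a chain are consecutive, so the chain has an unbroken run between the least and
      the greatest index in \<open>T\<close>.\<close>
    define a where "a = Min T"
    have "T \<subseteq> {a..Max T}" using \<open>finite T\<close> by (auto simp: a_def)
    then have "card T \<le> card {a..Max T}" by (intro card_mono) auto
    then have "a + int (m + 2) \<le> Max T" using \<open>card T = m + 3\<close> by simp
    moreover have "a \<in> J" "Max T \<in> J"
      using T(1) Min_in[OF \<open>finite T\<close> \<open>T \<noteq> {}\<close>] Max_in[OF \<open>finite T\<close> \<open>T \<noteq> {}\<close>] by (auto simp: a_def)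
    ultimately have aJ: "a + int i \<in> J" if "i \<le> m + 2" for i
      using J[of a "Max T" "a + int i"] that by auto
    define H where "H i = h (a + int i)" for i
    have sepH: "separates (H j) (H 0) (H (m + 2))" if "0 < j" "j < m + 2" for j
    proof (rule chain_separates_ends[of "m + 2"])
      fix i assume i: "0 < i" "i < m + 2"
      have "{a + int i - 1, a + int i, a + int i + 1} \<subseteq> J"
        using aJ[of "i - 1"] aJ[of i] aJ[of "i + 1"] i by (auto simp: of_nat_diff algebra_simps)
      from sep[OF this] show "separates (H i) (H (i - 1)) (H (i + 1))"
        using i by (simp add: H_def of_nat_diff algebra_simps)
    qed (use cur aJ that in \<open>auto simp: H_def\<close>)
    obtain u v where u: "u \<in> H 0" "u \<in> W" and v: "v \<in> H (m + 2)" "v \<in> W"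
      using meet[of "H 0"] meet[of "H (m + 2)"] aJ[of 0] aJ[of "m + 2"] unfolding h H_def by auto
    have Hdisj: "H i \<inter> H j = {}" if "i \<le> m + 2" "j \<le> m + 2" "i \<noteq> j" for i j
      unfolding H_def using disj aJ that by auto
    have inj: "inj_on H {1..m + 1}"
    proof (rule inj_onI, rule ccontr)
      fix i j assume ij: "i \<in> {1..m + 1}" "j \<in> {1..m + 1}" "H i = H j" "i \<noteq> j"
      then have "H i = {}" using Hdisj[of i j] by auto
      then show False using curtain_nonempty[OF cur[OF aJ[of i]]] ij by (auto simp: H_def)
    qed
    have "real (card (H ` {1..m + 1})) \<le> dist u v"
    proof (rule card_disjoint_separating_le)
      show "separates k {u} {v}" if "k \<in> H ` {1..m + 1}" for k
      proof -
        obtain j where "k = H j" "0 < j" "j < m + 2" using \<open>k \<in> H ` {1..m + 1}\<close> by force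
        then show ?thesis using sepH[of j] u v unfolding separates_def by blast
      qed
    next
      fix k k' assume k: "k \<in> H ` {1..m + 1}" "k' \<in> H ` {1..m + 1}" "k \<noteq> k'"
      from k(1,2) obtain i j where ij: "k = H i" "k' = H j" "i \<in> {1..m + 1}" "j \<in> {1..m + 1}"
        by (elim imageE)
      with k(3) have "i \<noteq> j" by blast
      then show "k \<inter> k' = {}" using Hdisj[of i j] ij by simp
    qed
    also have "\<dots> \<le> real m" using W[OF u(2) v(2)] .
    finally show False unfolding card_image[OF inj] by simp
  qed
qed

section \<open>Bounds on the curtain distances\<close>

lemma L_separated_sym: "L_separated L h k \<Longrightarrow> L_separated L k h"
  unfolding L_separated_def by (simp add: Int_commute conj_commute)

lemma L_separatedD: "L_separated L h k \<Longrightarrow> is_curtain h \<and> h \<inter> k = {}"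
  unfolding L_separated_def by simp

lemma L_chain_empty: "L_chain L {}"
  unfolding L_chain_def chain_def by (simp add: exI[of _ "{}"])

lemma card_separating_chain_le:
  fixes x y :: "'a::cat0_space"
  assumes "chain c" "chain_separates c {x} {y}"
  shows "real (card c) \<le> dist x y"
  using assms chain_elements_disjoint[OF assms(1)]
  by (intro card_disjoint_separating_le) (auto simp: chain_separates_def)

text \<open>The bound on separating chains shows that the maximum in the definition of \<open>d\<^sub>L\<close> is taken over
  a finite set, so that it is attained and is an upper bound.\<close>

lemma curtain_dist_L_bounds:
  fixes x y :: "'a::cat0_space"
  shows "real (curtain_dist_L L x y) \<le> 1 + dist x y"
    and "\<lbrakk>x \<noteq> y; L_chain L c; chain_separates c {x} {y}\<rbrakk> \<Longrightarrow> 1 + card c \<le> curtain_dist_L L x y"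
proof -
  let ?S = "{card c |c. L_chain L c \<and> chain_separates c {x} {y}}"
  have le: "real n \<le> dist x y" if "n \<in> ?S" for n
    using that card_separating_chain_le unfolding L_chain_def by blast
  then have "?S \<subseteq> {..nat \<lfloor>dist x y\<rfloor>}" by (intro subsetI) (simp only: atMost_iff le_nat_floor)
  then have fin: "finite ?S" by (rule finite_subset) simp
  have "card ({} :: 'a set set) \<in> ?S"
    by (intro CollectI exI[of _ "{}"]) (simp add: L_chain_empty chain_separates_def)
  then have "Max ?S \<in> ?S" using fin by (intro Max_in) auto
  from le[OF this] show "real (curtain_dist_L L x y) \<le> 1 + dist x y"
    by (simp add: curtain_dist_L_def)
  show "1 + card c \<le> curtain_dist_L L x y"
    if "x \<noteq> y" "L_chain L c" "chain_separates c {x} {y}"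
  proof -
    have "card c \<le> Max ?S" using fin that by (intro Max_ge) blast+
    then show ?thesis using that(1) by (simp add: curtain_dist_L_def)
  qed
qed

lemma curtain_dist_L_commute: "curtain_dist_L L x y = curtain_dist_L L y x"
  unfolding curtain_dist_L_def chain_separates_def separates_commute[of _ "{x}"] by (simp add: eq_commute)

lemma curtain_dist_bounds:
  fixes x y :: "'a::cat0_space"
  assumes w: "curtain_weights w"
  shows "curtain_dist w x y \<le> (1 + dist x y) * (\<Sum>L. w (Suc L))"
    and "w (Suc L) * real (curtain_dist_L (Suc L) x y) \<le> curtain_dist w x y"
proof -
  have pos: "0 \<le> w (Suc L)" for L using w unfolding curtain_weights_def by (simp add: less_imp_le)
  have sw: "summable (\<lambda>L. w (Suc L))" using w unfolding curtain_weights_def by blast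
  have le: "w (Suc L) * real (curtain_dist_L (Suc L) x y) \<le> w (Suc L) * (1 + dist x y)" for L
    using curtain_dist_L_bounds(1) pos by (rule mult_left_mono)
  have s2: "summable (\<lambda>L. w (Suc L) * (1 + dist x y))" using sw by (rule summable_mult2)
  have s1: "summable (\<lambda>L. w (Suc L) * real (curtain_dist_L (Suc L) x y))"
    using s2 by (rule summable_comparison_test') (use le pos in \<open>simp add: abs_mult\<close>)
  show "curtain_dist w x y \<le> (1 + dist x y) * (\<Sum>L. w (Suc L))"
    using suminf_le[OF le s1 s2] suminf_mult2[OF sw, of "1 + dist x y"]
    unfolding curtain_dist_def by (simp add: mult.commute)
  show "w (Suc L) * real (curtain_dist_L (Suc L) x y) \<le> curtain_dist w x y"
    using sum_le_suminf[OF s1, of "{L}"] pos unfolding curtain_dist_def by simp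
qed

section \<open>Geodesics and curtains crossing a contracting line\<close>

text \<open>Contraction stated for the largest ball about \<open>x\<close> that misses the line, as a bound on how far
  the foot can move from the centre of such a ball.\<close>

locale contracting_line = projecting_geodesic UNIV \<gamma>
  for \<gamma> :: "real \<Rightarrow> 'a::cat0_space" +
  fixes R :: real
  assumes R: "1 \<le> R"
    and contracting: "dist x y < dist x (\<gamma> (foot UNIV \<gamma> x)) \<Longrightarrow> \<bar>foot UNIV \<gamma> x - foot UNIV \<gamma> y\<bar> \<le> R"
begin

lemma dist_line: "dist (\<gamma> s) (\<gamma> t) = \<bar>s - t\<bar>" by (simp add: dist_on)

abbreviation height :: "'a \<Rightarrow> real" where "height x \<equiv> dist x (\<gamma> (proj_coord x))"

text \<open>Two estimates pull against each other. Far from the line the foot moves slowly: a step of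
  length \<open>2 R + 1\<close> stays in a ball that misses the line, and so moves the foot by at most \<open>R\<close>,
  which is speed at most one half. On the other hand the two end pieces, of
  length just below the heights of the ends, move the foot by at most \<open>R\<close> each,
  and what remains in the middle is by the triangle inequality hardly longer than the distance
  of the two feet. Only a bounded distance of the feet satisfies both.\<close>

lemma far_geodesic_projection:
  assumes st: "s \<le> t" and \<sigma>: "\<And>u v. u \<in> {s..t} \<Longrightarrow> v \<in> {s..t} \<Longrightarrow> dist (\<sigma> u) (\<sigma> v) = \<bar>u - v\<bar>"
    and far: "\<And>u. u \<in> {s..t} \<Longrightarrow> 2 * R + 1 < height (\<sigma> u)"
  shows "\<bar>proj_coord (\<sigma> s) - proj_coord (\<sigma> t)\<bar> \<le> 6 * R + 2"
proof -
  define f where "f u = proj_coord (\<sigma> u)" for u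
  define h where "h u = height (\<sigma> u)" for u
  define K where "K = 2 * R + 1"
  have K: "K > 0" using R by (simp add: K_def)
  have hK: "K < h u" if "u \<in> {s..t}" for u using far[OF that] by (simp add: h_def K_def)
  have step: "\<bar>f u - f v\<bar> \<le> R" if "u \<in> {s..t}" "v \<in> {s..t}" "\<bar>u - v\<bar> < h u" for u v
    using contracting[of "\<sigma> u" "\<sigma> v"] \<sigma>[of u v] that unfolding f_def h_def by simp
  have steps: "\<bar>f u - f v\<bar> \<le> real n * R" if "u \<in> {s..t}" "v \<in> {s..t}" "u \<le> v" "v - u \<le> real n * K" for n u v
    using that
  proof (induction n arbitrary: u)
    case 0
    then show ?case by simp
  next
    case (Suc n)
    define z where "z = min v (u + K)"
    have z: "z \<in> {s..t}" "z \<le> v" "\<bar>u - z\<bar> \<le> K" using Suc.prems K by (auto simp: z_def min_def)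
    have "v - z \<le> real n * K" using Suc.prems K by (auto simp: z_def min_def algebra_simps)
    then have "\<bar>f z - f v\<bar> \<le> real n * R" using Suc.IH z Suc.prems by blast
    moreover have "\<bar>f u - f z\<bar> \<le> R" using step[of u z] hK[of u] z Suc.prems by simp
    ultimately show ?case by (simp add: algebra_simps)
  qed
  have slow: "\<bar>f u - f v\<bar> \<le> (v - u) / 2 + R" if "u \<in> {s..t}" "v \<in> {s..t}" "u \<le> v" for u v
  proof -
    let ?n = "nat \<lceil>(v - u) / K\<rceil>"
    have n: "(v - u) / K \<le> real ?n" "real ?n \<le> (v - u) / K + 1"
      using that K by (simp_all add: real_nat_ceiling_ge)
    have "v - u \<le> real ?n * K" using n(1) K by (simp add: field_simps)
    then have "\<bar>f u - f v\<bar> \<le> real ?n * R" using steps that by blast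
    also have "\<dots> \<le> ((v - u) / K + 1) * R" using n(2) R by (intro mult_right_mono) auto
    also have "\<dots> = (v - u) * (R / K) + R" by (simp add: algebra_simps)
    also have "(v - u) * (R / K) \<le> (v - u) * (1 / 2)"
      using that K R by (intro mult_left_mono) (auto simp: K_def field_simps)
    finally show ?thesis by simp
  qed
  define P where "P = \<bar>f s - f t\<bar>"
  \<comment> \<open>The end pieces are shortened by one so that they lie in the open balls.\<close>
  define s' where "s' = s + (h s - 1)"
  define t' where "t' = t - (h t - 1)"
  have stin: "s \<in> {s..t}" "t \<in> {s..t}" using st by auto
  have ss: "s \<le> s'" "t' \<le> t" using hK[OF stin(1)] hK[OF stin(2)] R by (auto simp: K_def s'_def t'_def)
  have "P \<le> 6 * R + 2"
  proof (cases "s' < t'")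
    case True
    have "t - s = dist (\<sigma> s) (\<sigma> t)" using \<sigma>[OF stin] st by simp
    also have "\<dots> \<le> h s + P + h t"
      using dist_triangle[of "\<sigma> s" "\<sigma> t" "\<gamma> (f s)"] dist_triangle[of "\<gamma> (f s)" "\<sigma> t" "\<gamma> (f t)"]
      by (simp add: dist_line h_def f_def P_def dist_commute)
    finally have short: "t' - s' \<le> P + 2" by (simp add: s'_def t'_def)
    have in': "s' \<in> {s..t}" "t' \<in> {s..t}" using True ss by auto
    have "\<bar>f s - f s'\<bar> \<le> R" using step[OF stin(1) in'(1)] ss by (simp add: s'_def)
    moreover have "\<bar>f t - f t'\<bar> \<le> R" using step[OF stin(2) in'(2)] ss by (simp add: t'_def)
    moreover have "\<bar>f s' - f t'\<bar> \<le> (P + 2) / 2 + R" using slow[OF in'] True short by argo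
    ultimately show ?thesis unfolding P_def by argo
  next
    case False
    define z where "z = min t s'"
    have z: "z \<in> {s..t}" using ss st by (auto simp: z_def)
    have "\<bar>f s - f z\<bar> \<le> R" using step[OF stin(1) z] ss st by (auto simp: z_def s'_def)
    moreover have "\<bar>f t - f z\<bar> \<le> R"
      using step[OF stin(2) z] ss st False hK[OF stin(2)] K by (auto simp: z_def t'_def min_def)
    ultimately show ?thesis using R unfolding P_def by argo
  qed
  then show ?thesis by (simp add: P_def f_def)
qed

text \<open>Cut the geodesic down to a piece over \<open>{a..a + 6 * R + 3}\<close> whose ends lie over the ends of
  this interval. The piece cannot be far from the line throughout.\<close>

lemma geodesic_crossing_near_line:
  assumes u: "proj_coord u \<le> a" and v: "a + 6 * R + 3 \<le> proj_coord v"
  shows "\<exists>w. dist u w + dist w v = dist u v \<and> height w \<le> 2 * R + 1 \<and>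
    a \<le> proj_coord w \<and> proj_coord w \<le> a + 6 * R + 3"
proof (rule ccontr)
  assume none: "\<not> ?thesis"
  obtain \<sigma> where \<sigma>: "geodesic_between u v \<sigma>" using geodesic_between_exists by blast
  let ?l = "dist u v"
  have d: "\<And>s t. s \<in> {0..?l} \<Longrightarrow> t \<in> {0..?l} \<Longrightarrow> dist (\<sigma> s) (\<sigma> t) = \<bar>s - t\<bar>" "\<sigma> 0 = u" "\<sigma> ?l = v"
    using \<sigma> unfolding geodesic_between_def geodesic_def by blast+
  have "continuous_on {0..?l} \<sigma>" unfolding continuous_on_iff dist_real_def by (metis d(1))
  then have "continuous_on {0..?l} (\<lambda>t. proj_coord (\<sigma> t))"
    by (rule continuous_on_compose2[OF continuous_on_foot]) auto
  then obtain s t where st: "0 \<le> s" "s < t" "t \<le> ?l" "proj_coord (\<sigma> s) = a"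
      "proj_coord (\<sigma> t) = a + 6 * R + 3"
      "\<And>z. z \<in> {s..t} \<Longrightarrow> proj_coord (\<sigma> z) \<in> {a..a + 6 * R + 3}"
    using crossing_interval[of ?l "\<lambda>t. proj_coord (\<sigma> t)" a "a + 6 * R + 3"] u v R by (auto simp: d)
  have "2 * R + 1 < height (\<sigma> z)" if z: "z \<in> {s..t}" for z
  proof -
    have "dist u (\<sigma> z) + dist (\<sigma> z) v = ?l"
      using d(1)[of 0 z] d(1)[of z ?l] z st(1,3) by (simp add: d(2,3))
    then show ?thesis using none st(6)[OF z] by force
  qed
  then have "\<bar>proj_coord (\<sigma> s) - proj_coord (\<sigma> t)\<bar> \<le> 6 * R + 2"
    using st(1-3) by (intro far_geodesic_projection d(1)) auto
  then show False using st(4,5) R by simp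
qed

text \<open>A curtain need not be convex, but it contains the geodesics from \<open>x\<close> and from \<open>y\<close> to their
  closest points on its own dual line, and these two closest points are at distance at most one.
  As \<open>12 R + 7 = 2 (6 R + 3) + 1\<close>, one of the two geodesics crosses, over \<open>\<gamma>\<close>, the first or the
  last piece of length \<open>6 R + 3\<close> of the interval.\<close>

lemma curtain_crossing_near_line:
  assumes k: "is_curtain k" "x \<in> k" "y \<in> k"
    and x: "proj_coord x \<le> a" and y: "a + (12 * R + 7) \<le> proj_coord y"
  shows "\<exists>w\<in>k. height w \<le> 2 * R + 1 \<and> a \<le> proj_coord w \<and> proj_coord w \<le> a + (12 * R + 7)"
proof -
  obtain I \<beta> r where \<beta>: "curtain_data I \<beta> r" "k = curtain I \<beta> r" using k(1) unfolding is_curtain_def by blast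
  interpret \<beta>: projecting_geodesic I \<beta> using \<beta>(1) by (rule curtain_dataD)
  note mem = \<beta>.mem_curtain_iff[OF curtain_dataD(2)[OF \<beta>(1)]]
  define x' where "x' = \<beta> (\<beta>.proj_coord x)"
  define y' where "y' = \<beta> (\<beta>.proj_coord y)"
  have ray: "w \<in> k" if "z \<in> k" "dist z w + dist w (\<beta> (\<beta>.proj_coord z)) = dist z (\<beta> (\<beta>.proj_coord z))" for z w
    using that(1) \<beta>.foot_between[OF that(2)] unfolding \<beta>(2) mem by simp
  have "dist x' y' \<le> 1"
    using k(2,3) \<beta>.foot unfolding \<beta>(2) mem x'_def y'_def by (simp add: \<beta>.dist_on abs_le_iff)
  then have close: "\<bar>proj_coord x' - proj_coord y'\<bar> \<le> 1" using foot_lipschitz[of x' y'] by simp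
  show ?thesis
  proof (cases "a + 6 * R + 3 \<le> proj_coord x'")
    case True
    then obtain w where "dist x w + dist w x' = dist x x'" "height w \<le> 2 * R + 1"
        "a \<le> proj_coord w" "proj_coord w \<le> a + 6 * R + 3"
      using geodesic_crossing_near_line[OF x] by blast
    then show ?thesis using ray[OF k(2)] R unfolding x'_def by force
  next
    case False
    then have "proj_coord y' \<le> a + 6 * R + 4" using close by simp
    moreover have "(a + 6 * R + 4) + 6 * R + 3 \<le> proj_coord y" using y by simp
    ultimately obtain w where "dist y' w + dist w y = dist y' y" "height w \<le> 2 * R + 1"
        "a + 6 * R + 4 \<le> proj_coord w" "proj_coord w \<le> (a + 6 * R + 4) + 6 * R + 3"
      using geodesic_crossing_near_line by blast
    moreover from this(1) have "w \<in> k" by (intro ray[OF k(3)]) (simp add: y'_def dist_commute add.commute)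
    ultimately show ?thesis using R by force
  qed
qed

lemma curtain_data_line: "curtain_data UNIV \<gamma> r"
  by (rule curtain_dataI_line) unfold_locales

text \<open>The set of points of height at most \<open>2 R + 1\<close> over an interval of length \<open>12 R + 7\<close> has diameter at
  most \<open>16 R + 9\<close>; the summand \<open>2\<close> comes from the two ends of a chain whose elements all meet
  this set.\<close>

definition separation :: nat where "separation = nat \<lceil>16 * R + 9\<rceil> + 2"

text \<open>Every element of a chain that meets both curtains passes near \<open>\<gamma>\<close> over the interval of length
  \<open>12 R + 7\<close> that follows the first curtain. The interval does not depend on the second
  curtain, so one bound serves all pairs.\<close>

lemma curtain_L_separated:
  assumes "r + (12 * R + 8) \<le> r'"
  shows "L_separated separation (curtain UNIV \<gamma> r) (curtain UNIV \<gamma> r')"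
proof -
  note mem = mem_curtain_iff[OF subset_UNIV]
  let ?a = "r + 1/2"
  let ?W = "{w. height w \<le> 2 * R + 1 \<and> ?a \<le> proj_coord w \<and> proj_coord w \<le> ?a + (12 * R + 7)}"
  have W: "dist u v \<le> real (nat \<lceil>16 * R + 9\<rceil>)" if "u \<in> ?W" "v \<in> ?W" for u v
  proof -
    have "dist u v \<le> height u + dist (\<gamma> (proj_coord u)) (\<gamma> (proj_coord v)) + height v"
      using dist_triangle[of u v "\<gamma> (proj_coord u)"]
        dist_triangle[of "\<gamma> (proj_coord u)" v "\<gamma> (proj_coord v)"] by (simp add: dist_commute)
    also have "\<dots> \<le> (2 * R + 1) + (12 * R + 7) + (2 * R + 1)"
      using that by (intro add_mono) (auto simp: dist_line abs_le_iff)
    also have "\<dots> \<le> real (nat \<lceil>16 * R + 9\<rceil>)" using real_nat_ceiling_ge[of "16 * R + 9"] by simp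
    finally show ?thesis .
  qed
  have "finite c \<and> card c \<le> separation"
    if c: "chain c" and meet: "\<And>k. k \<in> c \<Longrightarrow> k \<inter> curtain UNIV \<gamma> r \<noteq> {} \<and> k \<inter> curtain UNIV \<gamma> r' \<noteq> {}" for c
    unfolding separation_def
  proof (rule chain_meeting_bounded_set[OF c _ W])
    fix k assume k: "k \<in> c"
    obtain x where x: "x \<in> k" "x \<in> curtain UNIV \<gamma> r" using meet[OF k] by blast
    obtain y where y: "y \<in> k" "y \<in> curtain UNIV \<gamma> r'" using meet[OF k] by blast
    have "is_curtain k" using c k unfolding chain_def by blast
    from curtain_crossing_near_line[OF this x(1) y(1), of ?a]
    show "k \<inter> ?W \<noteq> {}" using x(2) y(2) assms unfolding mem by auto
  qed
  moreover have "curtain UNIV \<gamma> r \<inter> curtain UNIV \<gamma> r' = {}" using assms R by (auto simp: mem)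
  ultimately show ?thesis unfolding L_separated_def is_curtain_def using curtain_data_line by blast
qed

section \<open>Equally spaced curtains dual to a contracting line\<close>

definition spacing :: real where "spacing = 12 * R + 8"

definition wall :: "int \<Rightarrow> 'a set" where "wall n = curtain UNIV \<gamma> (real_of_int n * spacing)"

lemma spacing_gt: "20 \<le> spacing" using R by (simp add: spacing_def)

lemma walls_spaced: "i < j \<Longrightarrow> real_of_int i * spacing + spacing \<le> real_of_int j * spacing"
proof -
  assume "i < j"
  then have "(real_of_int i + 1) * spacing \<le> real_of_int j * spacing"
    using spacing_gt by (intro mult_right_mono) auto
  then show ?thesis by (simp add: algebra_simps)
qed

lemma wall_separates:
  assumes "\<And>p. p \<in> A \<Longrightarrow> proj_coord p < real_of_int n * spacing - 1/2"
    and "\<And>q. q \<in> B \<Longrightarrow> real_of_int n * spacing + 1/2 < proj_coord q"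
  shows "separates (wall n) A B"
  unfolding separates_def wall_def using assms curtain_data_line
  by (intro exI[of _ UNIV] exI[of _ \<gamma>] exI[of _ "real_of_int n * spacing"])
    (auto simp: mem_halfspace_minus_iff mem_halfspace_plus_iff)

lemma walls_L_separated: "i \<noteq> j \<Longrightarrow> L_separated separation (wall i) (wall j)"
proof -
  have main: "L_separated separation (wall i) (wall j)" if "i < j" for i j
    using walls_spaced[OF that] unfolding wall_def spacing_def by (intro curtain_L_separated)
  assume "i \<noteq> j"
  then consider "i < j" | "j < i" by linarith
  then show ?thesis by cases (rule main L_separated_sym[OF main], assumption)+
qed

lemma walls_L_chain: "L_chain separation (wall ` {i..j})"
proof -
  have "chain (wall ` {i..j})"
    unfolding chain_def
  proof (intro exI[of _ "{i..j}"] exI[of _ wall] conjI ballI allI impI)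
    fix n assume "{n - 1, n, n + 1} \<subseteq> {i..j}"
    show "separates (wall n) (wall (n - 1)) (wall (n + 1))"
    proof (rule wall_separates)
      fix p assume "p \<in> wall (n - 1)"
      then show "proj_coord p < real_of_int n * spacing - 1/2"
        using walls_spaced[of "n - 1" n] spacing_gt by (simp add: wall_def mem_curtain_iff)
    next
      fix q assume "q \<in> wall (n + 1)"
      then show "real_of_int n * spacing + 1/2 < proj_coord q"
        using walls_spaced[of n "n + 1"] spacing_gt by (simp add: wall_def mem_curtain_iff)
    qed
  next
    fix n m :: int assume "n \<noteq> m"
    then show "wall n \<inter> wall m = {}" using L_separatedD[OF walls_L_separated] by blast
  next
    show "is_curtain (wall n)" for n :: int unfolding is_curtain_def wall_def using curtain_data_line by blast
  qed auto
  moreover have "L_separated separation h k" if hk: "h \<in> wall ` {i..j}" "k \<in> wall ` {i..j}" "h \<noteq> k" for h k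
  proof -
    obtain n m where "h = wall n" "k = wall m" using hk(1,2) by blast
    then show ?thesis using hk(3) walls_L_separated[of n m] by auto
  qed
  ultimately show ?thesis unfolding L_chain_def by simp
qed

lemma inj_wall: "inj_on wall A"
proof (rule inj_onI, rule ccontr)
  fix i j assume "wall i = wall j" "i \<noteq> j"
  then show False using L_separatedD[OF walls_L_separated[of i j]] curtain_nonempty[of "wall i"] by auto
qed

text \<open>The walls over the interval between the two feet form an \<open>L\<close>-chain that separates the points,
  where \<open>L\<close> is \<^const>\<open>separation\<close>. Their number is rounded down by at most one, for which the
  summand \<open>1\<close> in \<open>d\<^sub>L\<close> makes up; the subtracted \<open>1\<close> covers the width of the walls.\<close>

lemma proj_coord_le_curtain_dist_L:
  "\<bar>proj_coord x - proj_coord y\<bar> / spacing - 1 \<le> real (curtain_dist_L separation x y)"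
proof (induction "proj_coord x" "proj_coord y" arbitrary: x y rule: linorder_wlog)
  case (sym x y)
  then show ?case by (metis abs_minus_commute curtain_dist_L_commute)
next
  case (le x y)
  show ?case
  proof (cases "proj_coord x = proj_coord y")
    case False
    define i where "i = \<lfloor>(proj_coord x + 1/2) / spacing\<rfloor> + 1"
    define j where "j = \<lceil>(proj_coord y - 1/2) / spacing\<rceil> - 1"
    have pos: "0 < spacing" using spacing_gt by simp
    have "(proj_coord x + 1/2) / spacing < real_of_int i" "real_of_int j < (proj_coord y - 1/2) / spacing"
      by (simp_all add: i_def j_def) linarith+
    then have i: "proj_coord x + 1/2 < real_of_int i * spacing"
      and j: "real_of_int j * spacing < proj_coord y - 1/2"
      using pos by (simp_all add: field_simps)
    have "chain_separates (wall ` {i..j}) {x} {y}"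
      unfolding chain_separates_def
    proof
      fix h assume "h \<in> wall ` {i..j}"
      then obtain n where n: "h = wall n" "i \<le> n" "n \<le> j" by auto
      have "real_of_int i * spacing \<le> real_of_int n * spacing" "real_of_int n * spacing \<le> real_of_int j * spacing"
        using n pos by simp_all
      then show "separates h {x} {y}" unfolding n(1) using i j by (intro wall_separates) auto
    qed
    then have "1 + card (wall ` {i..j}) \<le> curtain_dist_L separation x y"
      using False by (intro curtain_dist_L_bounds(2) walls_L_chain) auto
    moreover have "card (wall ` {i..j}) = nat (j - i + 1)"
      by (simp add: card_image[OF inj_wall])
    ultimately have "1 + real (nat (j - i + 1)) \<le> real (curtain_dist_L separation x y)" by simp
    moreover have "real_of_int (j - i + 1) \<le> real (nat (j - i + 1))" by simp
    moreover have "(proj_coord y - 1/2) / spacing - (proj_coord x + 1/2) / spacing - 1 \<le> real_of_int (j - i + 1)"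
      by (simp add: i_def j_def) linarith
    moreover have "(proj_coord y - 1/2) / spacing - (proj_coord x + 1/2) / spacing
        = (proj_coord y - proj_coord x) / spacing - 1 / spacing"
      using pos by (simp add: field_simps)
    moreover have "1 / spacing \<le> 1" using spacing_gt by simp
    ultimately show ?thesis using le by (simp add: abs_if)
  qed simp
qed

text \<open>If the image of \<open>x\<close> were higher over the line than \<open>dist x y\<close>, then a ball about it that misses
  the line would contain the image of \<open>y\<close>, whereas the feet of the two images are
  more than \<open>R\<close> apart.\<close>

lemma isometry_displacement:
  assumes iso: "\<And>p q. dist (h p) (h q) = dist p q"
    and x: "\<bar>proj_coord x - proj_coord (h x)\<bar> \<le> B" and y: "\<bar>proj_coord y - proj_coord (h y)\<bar> \<le> B"
    and far: "2 * B + R < \<bar>proj_coord x - proj_coord y\<bar>"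
  shows "dist (h x) (\<gamma> (proj_coord x)) \<le> dist x y + B"
proof -
  have "height (h x) \<le> dist x y"
  proof (rule ccontr)
    assume "\<not> height (h x) \<le> dist x y"
    then have "\<bar>proj_coord (h x) - proj_coord (h y)\<bar> \<le> R" by (intro contracting) (simp add: iso)
    then show False using x y far by linarith
  qed
  moreover have "dist (\<gamma> (proj_coord (h x))) (\<gamma> (proj_coord x)) \<le> B" using x by (simp add: dist_line)
  ultimately show ?thesis
    using dist_triangle[of "h x" "\<gamma> (proj_coord x)" "\<gamma> (proj_coord (h x))"] by linarith
qed

end

lemma contracting_geodesic_line:
  assumes "contracting_geodesic UNIV (\<gamma> :: real \<Rightarrow> 'a::cat0_space)"
  shows "\<exists>R. contracting_line \<gamma> R"
proof -
  obtain R where geo: "geodesic UNIV \<gamma>"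
    and R: "\<And>x r. ball x r \<inter> range \<gamma> = {} \<Longrightarrow> bounded (closest_proj (range \<gamma>) ` ball x r)"
      "\<And>x r. ball x r \<inter> range \<gamma> = {} \<Longrightarrow> diameter (closest_proj (range \<gamma>) ` ball x r) \<le> R"
    using assms unfolding contracting_geodesic_def by blast
  interpret projecting_geodesic UNIV \<gamma> using geo by (rule projecting_geodesic_line)
  have "contracting_line \<gamma> (max 1 R)"
  proof
    fix x y assume xy: "dist x y < dist x (\<gamma> (proj_coord x))"
    let ?B = "ball x (dist x (\<gamma> (proj_coord x)))"
    have "\<gamma> t \<notin> ?B" for t using dist_foot_le[of t x] by simp
    then have B: "?B \<inter> range \<gamma> = {}" by blast
    have "0 < dist x (\<gamma> (proj_coord x))" using xy zero_le_dist[of x y] by linarith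
    then have "x \<in> ?B" "y \<in> ?B" using xy by auto
    then have "dist (closest_proj (range \<gamma>) x) (closest_proj (range \<gamma>) y)
        \<le> diameter (closest_proj (range \<gamma>) ` ?B)"
      by (intro diameter_bounded_bound R(1)[OF B] imageI)
    also have "\<dots> \<le> R" by (rule R(2)[OF B])
    finally show "\<bar>proj_coord x - proj_coord y\<bar> \<le> max 1 R" by (simp add: foot dist_on)
  qed simp
  then show ?thesis ..
qed

section \<open>Isometries translating a line\<close>

lemma group_isom_group: "group (isom_group :: ('a::metric_space \<Rightarrow> 'a) monoid)"
proof (rule groupI)
  fix f :: "'a \<Rightarrow> 'a" assume "f \<in> carrier isom_group"
  then have f: "bij f" "\<And>x y. dist (f x) (f y) = dist x y" by (auto simp: isom_group_def)
  let ?k = "inv_into UNIV f"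
  have "dist (?k x) (?k y) = dist x y" for x y
    using f(2)[of "?k x" "?k y"] by (simp add: surj_f_inv_f[OF bij_is_surj[OF f(1)]])
  then have "?k \<in> carrier isom_group" using bij_imp_bij_inv[OF f(1)] by (simp add: isom_group_def)
  moreover have "?k \<otimes>\<^bsub>isom_group\<^esub> f = \<one>\<^bsub>isom_group\<^esub>"
    using inv_o_cancel[OF bij_is_inj[OF f(1)]] by (simp add: isom_group_def)
  ultimately show "\<exists>k\<in>carrier isom_group. k \<otimes>\<^bsub>isom_group\<^esub> f = \<one>\<^bsub>isom_group\<^esub>" by blast
next
  fix f k :: "'a \<Rightarrow> 'a" assume "f \<in> carrier isom_group" "k \<in> carrier isom_group"
  then show "f \<otimes>\<^bsub>isom_group\<^esub> k \<in> carrier isom_group" by (simp add: isom_group_def bij_comp)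
qed (simp_all add: isom_group_def comp_assoc)

lemma nat_pow_translates:
  assumes "\<And>t. g (\<gamma> t) = \<gamma> (t + \<tau>)"
  shows "(g [^]\<^bsub>isom_group\<lparr>carrier := G\<rparr>\<^esub> (n::nat)) (\<gamma> t) = \<gamma> (t + real n * \<tau>)"
  by (induction n arbitrary: t) (simp_all add: isom_group_def assms algebra_simps)

lemma int_pow_translates:
  assumes G: "subgroup G isom_group" "g \<in> G" and g: "\<And>t. g (\<gamma> t) = \<gamma> (t + \<tau>)"
  shows "(g [^]\<^bsub>isom_group\<lparr>carrier := G\<rparr>\<^esub> (n::int)) (\<gamma> t) = \<gamma> (t + real_of_int n * \<tau>)"
proof -
  let ?H = "isom_group\<lparr>carrier := G\<rparr>"
  interpret H: group ?H using G(1) group_isom_group by (rule subgroup.subgroup_is_group)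
  have gH: "g \<in> carrier ?H" using G(2) by simp
  show ?thesis
  proof (cases n)
    case (nonneg k)
    then show ?thesis using nat_pow_translates[where g=g and \<gamma>=\<gamma> and \<tau>=\<tau>, OF g, of G k t] by (simp add: int_pow_int)
  next
    case (neg k)
    let ?a = "g [^]\<^bsub>?H\<^esub> Suc k" and ?s = "t - real (Suc k) * \<tau>"
    have "inv\<^bsub>?H\<^esub> ?a \<otimes>\<^bsub>?H\<^esub> ?a = \<one>\<^bsub>?H\<^esub>" using gH by (intro H.l_inv H.nat_pow_closed)
    then have "(inv\<^bsub>?H\<^esub> ?a \<circ> ?a) (\<gamma> ?s) = \<gamma> ?s" by (simp add: isom_group_def)
    moreover have "?a (\<gamma> ?s) = \<gamma> t" using nat_pow_translates[where g=g and \<gamma>=\<gamma> and \<tau>=\<tau>, OF g, of G "Suc k" ?s] by simp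
    ultimately have "(inv\<^bsub>?H\<^esub> ?a) (\<gamma> t) = \<gamma> ?s" by simp
    moreover have "g [^]\<^bsub>?H\<^esub> n = inv\<^bsub>?H\<^esub> ?a" unfolding neg by (rule H.int_pow_neg_int[OF gH])
    moreover have "?s = t + real_of_int n * \<tau>" unfolding neg by (simp add: algebra_simps)
    ultimately show ?thesis by metis
  qed
qed

section \<open>Contracting isometries are WPD loxodromics\<close>

theorem theorem5:
  fixes G :: "('a::cat0_space \<Rightarrow> 'a) set"
    and g :: "'a \<Rightarrow> 'a"
    and w :: "nat \<Rightarrow> real"
  assumes "subgroup G isom_group"
    and "acts_properly G"
    and "curtain_weights w"
    and "g \<in> G"
    and "contracting_isometry g"
  shows "WPD_loxodromic (isom_group\<lparr>carrier := G\<rparr>) UNIV (curtain_dist w) (\<lambda>h x. h x) g"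
proof -
  let ?H = "isom_group\<lparr>carrier := G\<rparr>"
  interpret H: group ?H using assms(1) group_isom_group by (rule subgroup.subgroup_is_group)
  have iso: "dist (h p) (h q) = dist p q" if "h \<in> G" for h p q
    using subgroup.subset[OF assms(1)] that by (auto simp: isom_group_def)
  obtain \<gamma> \<tau> where \<tau>: "\<tau> \<noteq> 0" and g\<gamma>: "\<And>t. g (\<gamma> t) = \<gamma> (t + \<tau>)" and "contracting_geodesic UNIV \<gamma>"
    using assms(5) unfolding contracting_isometry_def is_axis_def by blast
  then obtain R where "contracting_line \<gamma> R" using contracting_geodesic_line by blast
  then interpret contracting_line \<gamma> R .
  note pow = nat_pow_translates[where g=g and \<gamma>=\<gamma> and \<tau>=\<tau>, OF g\<gamma>]
    int_pow_translates[where g=g and \<gamma>=\<gamma> and \<tau>=\<tau>, OF assms(1,4) g\<gamma>]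
  \<comment> \<open>The weights start at index \<open>1\<close>, so the positivity of \<^const>\<open>separation\<close> matters here.\<close>
  obtain l where l: "separation = Suc l" by (simp add: separation_def)
  define \<omega> where "\<omega> = w (Suc l)"
  define \<Omega> where "\<Omega> = (\<Sum>L. w (Suc L))"
  have \<omega>: "0 < \<omega>" using assms(3) by (simp add: \<omega>_def curtain_weights_def)
  have S: "0 < spacing" using spacing_gt by simp
  have lower: "\<omega> * (\<bar>proj_coord x - proj_coord y\<bar> / spacing - 1) \<le> curtain_dist w x y" for x y
    using mult_left_mono[OF proj_coord_le_curtain_dist_L less_imp_le[OF \<omega>], of x y]
      curtain_dist_bounds(2)[OF assms(3), of l x y]
    unfolding l \<omega>_def by (rule order_trans)
  have upper: "curtain_dist w x y \<le> (1 + dist x y) * \<Omega>" for x y :: 'a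
    unfolding \<Omega>_def by (rule curtain_dist_bounds(1)[OF assms(3)])
  have torsion_free: "g [^]\<^bsub>?H\<^esub> n \<noteq> \<one>\<^bsub>?H\<^esub>" if "n > 0" for n :: nat
  proof
    assume "g [^]\<^bsub>?H\<^esub> n = \<one>\<^bsub>?H\<^esub>"
    then have "\<gamma> 0 = \<gamma> (0 + real n * \<tau>)" using pow(1)[of G n 0] by (simp add: isom_group_def)
    then show False using dist_line[of 0 "0 + real n * \<tau>"] that \<tau> by simp
  qed
  have qi: "qi_embedding_int (curtain_dist w) (\<lambda>n. (g [^]\<^bsub>?H\<^esub> n) (\<gamma> 0))"
  proof -
    define a where "a = \<omega> * (\<bar>\<tau>\<bar> / spacing)"
    have a: "0 < a" using \<omega> \<tau> S by (simp add: a_def)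
    define K where "K = max 1 (max (1 / a) (\<bar>\<tau>\<bar> * \<Omega>))"
    define C where "C = max \<omega> \<Omega>"
    have K: "1 \<le> K" "1 / K \<le> a" "\<bar>\<tau>\<bar> * \<Omega> \<le> K"
    proof -
      have "1 / K \<le> 1 / (1 / a)" using a by (intro divide_left_mono) (auto simp: K_def)
      then show "1 / K \<le> a" by simp
    qed (auto simp: K_def)
    have C: "0 \<le> C" "\<omega> \<le> C" "\<Omega> \<le> C" using \<omega> by (auto simp: C_def)
    have "\<bar>real_of_int m - real_of_int n\<bar> / K - C \<le> curtain_dist w (\<gamma> (real_of_int m * \<tau>)) (\<gamma> (real_of_int n * \<tau>))
      \<and> curtain_dist w (\<gamma> (real_of_int m * \<tau>)) (\<gamma> (real_of_int n * \<tau>)) \<le> K * \<bar>real_of_int m - real_of_int n\<bar> + C"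
      for m n
    proof -
      define N where "N = \<bar>real_of_int m - real_of_int n\<bar>"
      have N: "\<bar>real_of_int m * \<tau> - real_of_int n * \<tau>\<bar> = N * \<bar>\<tau>\<bar>" "0 \<le> N"
        by (simp_all add: N_def abs_mult flip: left_diff_distrib)
      have "N / K - C \<le> N * a - \<omega>" using mult_left_mono[OF K(2) N(2)] C(2) by simp
      also have "\<dots> = \<omega> * (N * \<bar>\<tau>\<bar> / spacing - 1)" by (simp add: a_def algebra_simps)
      finally have 1: "N / K - C \<le> \<omega> * (N * \<bar>\<tau>\<bar> / spacing - 1)" .
      have "(1 + N * \<bar>\<tau>\<bar>) * \<Omega> = \<Omega> + N * (\<bar>\<tau>\<bar> * \<Omega>)" by (simp add: algebra_simps)
      also have "\<dots> \<le> C + N * K" using C(3) mult_left_mono[OF K(3) N(2)] by (rule add_mono)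
      finally have 2: "(1 + N * \<bar>\<tau>\<bar>) * \<Omega> \<le> K * N + C" by (simp add: mult.commute add.commute)
      show ?thesis
        using 1 2 lower[of "\<gamma> (real_of_int m * \<tau>)" "\<gamma> (real_of_int n * \<tau>)"]
          upper[of "\<gamma> (real_of_int m * \<tau>)" "\<gamma> (real_of_int n * \<tau>)"]
        by (simp add: dist_line N N_def[symmetric])
    qed
    then show ?thesis using K(1) C(1) unfolding qi_embedding_int_def pow by auto
  qed
  have wpd: "\<exists>m::nat. m > 0 \<and> finite {h \<in> carrier ?H. curtain_dist w x (h x) < \<epsilon> \<and>
      curtain_dist w ((g [^]\<^bsub>?H\<^esub> m) x) (h ((g [^]\<^bsub>?H\<^esub> m) x)) < \<epsilon>}"
    if \<epsilon>: "0 < \<epsilon>" for \<epsilon> :: real and x :: 'a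
  proof -
    \<comment> \<open>The lower bound solved for the distance of the feet. No power of \<open>g\<close> enters \<open>B\<close>, so \<open>m\<close> can be
      chosen afterwards.\<close>
    define B where "B = spacing * (\<epsilon> / \<omega> + 1)"
    have B: "0 < B" using S \<epsilon> \<omega> by (simp add: B_def add_pos_pos)
    have moved: "\<bar>proj_coord p - proj_coord q\<bar> \<le> B" if "curtain_dist w p q < \<epsilon>" for p q
    proof -
      have "\<omega> * (\<bar>proj_coord p - proj_coord q\<bar> / spacing - 1) < \<epsilon>" using lower[of p q] that by linarith
      then show ?thesis using \<omega> S by (simp add: B_def field_simps)
    qed
    obtain m :: nat where m: "2 * B + R < real m * \<bar>\<tau>\<bar>"
      using reals_Archimedean3[of "\<bar>\<tau>\<bar>"] \<tau> by auto
    have "m > 0" using m B R by (intro gr0I) auto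
    define y where "y = (g [^]\<^bsub>?H\<^esub> m) x"
    have "g [^]\<^bsub>?H\<^esub> m \<in> carrier ?H" by (intro H.nat_pow_closed) (simp add: assms(4))
    then have "proj_coord y = proj_coord x + real m * \<tau>"
      unfolding y_def by (intro foot_translation iso pow) auto
    then have far: "2 * B + R < \<bar>proj_coord x - proj_coord y\<bar>" using m by (simp add: abs_mult)
    define p where "p = \<gamma> (proj_coord x)"
    define \<rho> where "\<rho> = 1 + dist x p + dist x y + B"
    have "{h \<in> carrier ?H. curtain_dist w x (h x) < \<epsilon> \<and> curtain_dist w y (h y) < \<epsilon>}
        \<subseteq> {h \<in> G. h ` ball p \<rho> \<inter> ball p \<rho> \<noteq> {}}"
    proof
      fix h assume "h \<in> {h \<in> carrier ?H. curtain_dist w x (h x) < \<epsilon> \<and> curtain_dist w y (h y) < \<epsilon>}"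
      then have h: "h \<in> G" "curtain_dist w x (h x) < \<epsilon>" "curtain_dist w y (h y) < \<epsilon>" by auto
      have "dist (h x) p \<le> dist x y + B"
        unfolding p_def using iso[of h] moved[OF h(2)] moved[OF h(3)] far h(1)
        by (intro isometry_displacement) auto
      then have "dist p x < \<rho>" "dist p (h x) < \<rho>"
        using B zero_le_dist[of x y] zero_le_dist[of x p] dist_commute[of p x] dist_commute[of p "h x"]
        unfolding \<rho>_def by linarith+
      then have "x \<in> ball p \<rho>" "h x \<in> ball p \<rho>" by simp_all
      then show "h \<in> {h \<in> G. h ` ball p \<rho> \<inter> ball p \<rho> \<noteq> {}}" using h(1) by blast
    qed
    moreover have "finite {h \<in> G. h ` ball p \<rho> \<inter> ball p \<rho> \<noteq> {}}"
      using assms(2) unfolding acts_properly_def by blast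
    ultimately show ?thesis using \<open>m > 0\<close> finite_subset unfolding y_def by blast
  qed
  show ?thesis
    unfolding WPD_loxodromic_def using assms(4) torsion_free qi wpd by (auto intro!: bexI[of _ "\<gamma> 0"])
qed

end
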